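(* Let $\Bbbk$ be a field and let $r \ge 2$ be an integer. Then there exist a standard graded polynomial ring $R$ over $\Bbbk$ (in finitely many variables) and a graded ideal $J$ of $R$ generated by $3$ forms of degree $22r-2$ such that $$\operatorname{reg}_R(J) \ge 2^{2^{r-1}} + 44r - 6.$$ In particular, $\Phi(3,d)$ is $2^{2^{\Omega(d)}}$; that is, for any function $\Phi(m,d)$ bounding the regularity of graded ideals generated by $m$ forms of degree at most $d$ (as defined in the context), there is a constant $c>0$ such that $\Phi(3,d) \ge 2^{2^{c d}}$ for all $d \gg 0$.
   Context: A standard graded polynomial ring over a field $\Bbbk$ is $S=\Bbbk[x_1,\ldots,x_n]$ with every variable of degree $1$. A form is a homogeneous polynomial, and a graded ideal is an ideal generated by forms. For a nonzero graded ideal $I$ of $S$, the (Castelnuovo-Mumford) regularity is $$\operatorname{reg}_S(I) = \max\{\, j-i \mid \operatorname{Tor}_i^S(I,\Bbbk)_j \neq 0 \,\}.$$ $\Phi(m,d)$ denotes a function such that every graded ideal $I$ generated by $m$ forms of degree at most $d$ in a standard graded polynomial ring over a field, with any number of variables, satisfies $\operatorname{reg}(I)\le \Phi(m,d)$. Such a function exists by a theorem of Ananyan and Hochster. A function $f:\mathbb{N}\to\mathbb{N}$ is $\Omega(g(n))$ if there is a constant $c>0$ such that $f(n)\ge c\cdot g(n)$ for $n\gg 0$. *)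

theory Defs
  imports "HOL-Library.Poly_Mapping" "HOL-Library.Extended_Real"
begin

section \<open>Standard graded polynomial rings\<close>

text \<open>
  The polynomials in all variables \<open>x\<^sub>0, x\<^sub>1, \<dots>\<close> form one type; the ring
  \<open>S = k[x\<^sub>0, \<dots>, x\<^sub>n\<^sub>-\<^sub>1]\<close> is the subring \<open>polys n\<close>. A monomial is its exponent
  function, so the key \<open>0\<close> carries the constant coefficient.
\<close>

type_synonym 'k mpoly = "(nat \<Rightarrow>\<^sub>0 nat) \<Rightarrow>\<^sub>0 'k"

definition polys :: "nat \<Rightarrow> 'k::field mpoly set" where
  "polys n = {p. \<forall>t \<in> Poly_Mapping.keys p. Poly_Mapping.keys t \<subseteq> {..<n}}"

definition mon_deg :: "(nat \<Rightarrow>\<^sub>0 nat) \<Rightarrow> nat" where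
  "mon_deg t = (\<Sum>v \<in> Poly_Mapping.keys t. Poly_Mapping.lookup t v)"

definition homogeneous :: "int \<Rightarrow> 'k::field mpoly \<Rightarrow> bool" where
  "homogeneous e p \<longleftrightarrow> (\<forall>t \<in> Poly_Mapping.keys p. int (mon_deg t) = e)"

text \<open>A form is required to be nonzero here, so that its degree is determined.\<close>

definition form_of_degree :: "nat \<Rightarrow> nat \<Rightarrow> 'k::field mpoly \<Rightarrow> bool" where
  "form_of_degree n d p \<longleftrightarrow> p \<in> polys n \<and> p \<noteq> 0 \<and> homogeneous (int d) p"

definition generated_ideal :: "nat \<Rightarrow> nat \<Rightarrow> (nat \<Rightarrow> 'k::field mpoly) \<Rightarrow> 'k mpoly set" where
  "generated_ideal n m f = {(\<Sum>i<m. a i * f i) | a. \<forall>i<m. a i \<in> polys n}"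


section \<open>Graded free modules\<close>

text \<open>
  \<open>free_module n B\<close> is the free \<open>S\<close>-module on the basis \<open>B\<close>, as finitely supported
  coordinate vectors. If the basis element \<open>b\<close> has degree \<open>\<delta> b\<close>, it is
  \<open>\<Oplus>\<^sub>b S(-\<delta> b)\<close>, and \<open>vec_homogeneous \<delta> j\<close> describes its component of degree \<open>j\<close>.
\<close>

definition free_module :: "nat \<Rightarrow> nat set \<Rightarrow> (nat \<Rightarrow>\<^sub>0 'k::field mpoly) set" where
  "free_module n B =
     {v. Poly_Mapping.keys v \<subseteq> B \<and> (\<forall>b. Poly_Mapping.lookup v b \<in> polys n)}"

definition vec_homogeneous :: "(nat \<Rightarrow> int) \<Rightarrow> int \<Rightarrow> (nat \<Rightarrow>\<^sub>0 'k::field mpoly) \<Rightarrow> bool" where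
  "vec_homogeneous \<delta> j v \<longleftrightarrow> (\<forall>b. homogeneous (j - \<delta> b) (Poly_Mapping.lookup v b))"

definition vec_scale :: "'k::field mpoly \<Rightarrow> (nat \<Rightarrow>\<^sub>0 'k mpoly) \<Rightarrow> (nat \<Rightarrow>\<^sub>0 'k mpoly)" where
  "vec_scale s v = Poly_Mapping.map (\<lambda>p. s * p) v"

text \<open>\<open>S\<close>-linearity on \<open>F\<close>; \<open>sc\<close> is the scalar multiplication of the codomain.\<close>

definition linear_map_on ::
  "nat \<Rightarrow> (nat \<Rightarrow>\<^sub>0 'k::field mpoly) set \<Rightarrow> ('k mpoly \<Rightarrow> 'b \<Rightarrow> 'b::ab_group_add)
    \<Rightarrow> ((nat \<Rightarrow>\<^sub>0 'k mpoly) \<Rightarrow> 'b) \<Rightarrow> bool" where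
  "linear_map_on n F sc \<phi> \<longleftrightarrow>
     (\<forall>v\<in>F. \<forall>w\<in>F. \<phi> (v + w) = \<phi> v + \<phi> w) \<and>
     (\<forall>s\<in>polys n. \<forall>v\<in>F. \<phi> (vec_scale s v) = sc s (\<phi> v))"


section \<open>Graded free resolutions, Tor and regularity\<close>

text \<open>
  The data of an augmented complex \<open>\<dots> \<rightarrow> F\<^sub>2 \<rightarrow> F\<^sub>1 \<rightarrow> F\<^sub>0 \<rightarrow> I\<close> of graded free modules.
  The map \<open>bdry C i\<close> goes from \<open>F\<^sub>i\<^sub>+\<^sub>1\<close> to \<open>F\<^sub>i\<close>. Countable bases suffice to resolve any
  graded ideal, since every graded component of \<open>S\<close> is finite dimensional.
\<close>

record (overloaded) ('k::zero) free_complex =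
  basis :: "nat \<Rightarrow> nat set"
  shift :: "nat \<Rightarrow> nat \<Rightarrow> int"
  bdry :: "nat \<Rightarrow> (nat \<Rightarrow>\<^sub>0 'k mpoly) \<Rightarrow> (nat \<Rightarrow>\<^sub>0 'k mpoly)"
  augm :: "(nat \<Rightarrow>\<^sub>0 'k mpoly) \<Rightarrow> 'k mpoly"

definition module_at :: "nat \<Rightarrow> 'k::field free_complex \<Rightarrow> nat \<Rightarrow> (nat \<Rightarrow>\<^sub>0 'k mpoly) set" where
  "module_at n C i = free_module n (basis C i)"

definition graded_free_resolution ::
  "nat \<Rightarrow> 'k::field mpoly set \<Rightarrow> 'k free_complex \<Rightarrow> bool" where
  "graded_free_resolution n I C \<longleftrightarrow>
     linear_map_on n (module_at n C 0) (*) (augm C) \<and>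
     (\<forall>j. \<forall>v \<in> module_at n C 0. vec_homogeneous (shift C 0) j v \<longrightarrow> homogeneous j (augm C v)) \<and>
     (\<forall>i. linear_map_on n (module_at n C (Suc i)) vec_scale (bdry C i) \<and>
          (\<forall>j. \<forall>v \<in> module_at n C (Suc i). vec_homogeneous (shift C (Suc i)) j v
                 \<longrightarrow> vec_homogeneous (shift C i) j (bdry C i v))) \<and>
     augm C ` module_at n C 0 = I \<and>
     bdry C 0 ` module_at n C 1 = {v \<in> module_at n C 0. augm C v = 0} \<and>
     (\<forall>i. bdry C (Suc i) ` module_at n C (Suc (Suc i)) =
            {v \<in> module_at n C (Suc i). bdry C i v = 0})"

text \<open>
  \<open>const_part\<close> is the canonical map from the free \<open>S\<close>-module \<open>F\<close> on \<open>B\<close> onto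
  \<open>F \<otimes>\<^sub>S k = F / S\<^sub>+ F\<close>, the \<open>k\<close>-vector space on \<open>B\<close>. The differential of \<open>F \<otimes>\<^sub>S k\<close> sends
  \<open>const_part v\<close> to \<open>const_part (bdry C i v)\<close>, and it is zero on \<open>F\<^sub>0 \<otimes>\<^sub>S k\<close>.
\<close>

definition const_part :: "(nat \<Rightarrow>\<^sub>0 'k::field mpoly) \<Rightarrow> (nat \<Rightarrow>\<^sub>0 'k)" where
  "const_part v = Poly_Mapping.map (\<lambda>p. Poly_Mapping.lookup p 0) v"

definition tor_cycles ::
  "nat \<Rightarrow> 'k::field free_complex \<Rightarrow> nat \<Rightarrow> int \<Rightarrow> (nat \<Rightarrow>\<^sub>0 'k) set" where
  "tor_cycles n C i j =
     {const_part v | v. v \<in> module_at n C i \<and> vec_homogeneous (shift C i) j v \<and>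
        (\<forall>h. i = Suc h \<longrightarrow> const_part (bdry C h v) = 0)}"

definition tor_boundaries ::
  "nat \<Rightarrow> 'k::field free_complex \<Rightarrow> nat \<Rightarrow> int \<Rightarrow> (nat \<Rightarrow>\<^sub>0 'k) set" where
  "tor_boundaries n C i j =
     {const_part (bdry C i v) | v. v \<in> module_at n C (Suc i) \<and>
        vec_homogeneous (shift C (Suc i)) j v}"

text \<open>
  \<open>Tor\<^sub>i\<^sup>S(I,k)\<^sub>j \<noteq> 0\<close>, where Tor is the homology of \<open>F \<otimes>\<^sub>S k\<close> for a graded free resolution
  \<open>F\<close> of \<open>I\<close>. The choice of \<open>F\<close> is immaterial.
\<close>

definition tor_nonzero :: "nat \<Rightarrow> 'k::field mpoly set \<Rightarrow> nat \<Rightarrow> int \<Rightarrow> bool" where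
  "tor_nonzero n I i j \<longleftrightarrow>
     (\<exists>C. graded_free_resolution n I C \<and> tor_cycles n C i j \<noteq> tor_boundaries n C i j)"

text \<open>
  For a nonzero graded ideal the set below is nonempty and finite by Hilbert's syzygy
  theorem, so the supremum is the maximum. Taking it in the extended reals avoids an
  unspecified value of \<open>Max\<close>.
\<close>

definition regularity :: "nat \<Rightarrow> 'k::field mpoly set \<Rightarrow> ereal" where
  "regularity n I = Sup {ereal (real_of_int (j - int i)) | i j. tor_nonzero n I i j}"

text \<open>
  \<open>\<Phi> m d\<close> bounds the regularity of every nonzero graded ideal generated by \<open>m\<close> forms of
  degree at most \<open>d\<close>, in any number of variables over the field \<open>'k\<close>. A function that
  does so over all fields is in particular such a bound for each single field.
\<close>

definition regularity_bound :: "'k::field itself \<Rightarrow> (nat \<Rightarrow> nat \<Rightarrow> nat) \<Rightarrow> bool" where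
  "regularity_bound _ \<Phi> \<longleftrightarrow>
     (\<forall>m d n (f :: nat \<Rightarrow> 'k mpoly).
        (\<forall>i<m. \<exists>e\<le>d. form_of_degree n e (f i)) \<longrightarrow> generated_ideal n m f \<noteq> {0} \<longrightarrow>
        regularity n (generated_ideal n m f) \<le> ereal (real (\<Phi> m d)))"

end

(*
  Let D = 22 r - 2. The three forms are u^D, v^D and g = sum_l f_l u^l v^(D-5-l), where the f_l are
  quintics in further variables. Modulo (u^D, v^D) the coefficient of u^(D-1) v^(D-1) in c g is
  sum_l a_l f_l, where a_l is the coefficient of u^(D-1-l) v^(4+l) in c. So a multiplier c of g into
  (u^D, v^D) yields a syzygy of the f_l, and conversely every syzygy arises in this way.

  The f_l are a start monomial f_0, an accepting monomial, and homogenized binomials in the style of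
  Mayr and Meyer that encode repeated squaring, with z as the homogenizing variable. Then
  z^K f_0 lies in the ideal of the other f_l for large K, but a monomial congruent to z^k f_0 that is
  divisible by the accepting monomial has degree above 2^(2^L), L = r + 1. Summing coefficients over
  a set of monomials closed under the binomials shows that multipliers of g of degree at most 2^(2^L)
  generate only multipliers in which no z^k u^(D-1) v^4 occurs, hence a minimal first syzygy of the
  three forms of larger degree exists.
*)
theory Submission
  imports Defs "HOL-Library.Countable_Set"
begin

section \<open>Graded modules\<close>

text \<open>Regularity is a supremum over all graded free resolutions, so a lower bound needs only
  one whose first module has a basis mapping to the three forms. It is built by dependent choice
  with countable bases, in general not minimal. Minimal generators of the syzygy module are avoided:
  it is enough to have a submodule \<open>U\<close> that contains every homogeneous syzygy of small
  degree but not all syzygies. The constants come from the packing. A side of a rule has at most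
  five variables, hence quintics. Each level costs ten rules and squares the exponent, so 10 L + 6
  quintics encode 2^(2^L), and u^l v^(D-5-l) for all their indices l needs D >= 10 L + 10. With L =
  r + 1 and D = 22 r - 2 this holds from r = 2 on, whereas L = r gives too small a value for r = 2.
  An ideal sees only congruence, so rules run both ways. Counters are therefore emptied by running
  the filling routine backwards, and the invariant behind the degree bound has to be preserved in
  both directions.\<close>

lemma polys_closed [intro, simp]:
  "0 \<in> polys n" "1 \<in> polys n"
  "p \<in> polys n \<Longrightarrow> q \<in> polys n \<Longrightarrow> p + q \<in> polys n"
  "p \<in> polys n \<Longrightarrow> - p \<in> polys n"
  "p \<in> polys n \<Longrightarrow> q \<in> polys n \<Longrightarrow> p - q \<in> polys n"
proof -
  show "0 \<in> polys n" "1 \<in> polys n"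
    by (auto simp: polys_def)
  show add: "p + q \<in> polys n" if "p \<in> polys n" "q \<in> polys n" for p q
    using that keys_add[of p q] by (auto simp: polys_def)
  show "- p \<in> polys n" if "p \<in> polys n"
    using that by (auto simp: polys_def in_keys_iff)
  then show "p - q \<in> polys n" if "p \<in> polys n" "q \<in> polys n"
    using that add[of p "- q"] by (auto simp: polys_def in_keys_iff)
qed

lemma polys_mult [intro, simp]:
  assumes "p \<in> polys n" "q \<in> polys n"
  shows "p * q \<in> polys n"
proof -
  have "Poly_Mapping.keys t \<subseteq> {..<n}" if t: "t \<in> Poly_Mapping.keys (p * q)" for t
  proof -
    obtain a b where "t = a + b" "a \<in> Poly_Mapping.keys p" "b \<in> Poly_Mapping.keys q"
      using t subsetD[OF keys_mult[of p q]] by blast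
    then show ?thesis
      using assms keys_add[of a b] by (force simp: polys_def)
  qed
  then show ?thesis by (auto simp: polys_def)
qed

lemma polys_sum [intro]: "(\<And>i. i \<in> A \<Longrightarrow> f i \<in> polys n) \<Longrightarrow> (\<Sum>i\<in>A. f i) \<in> polys n"
  by (induction A rule: infinite_finite_induct) auto

lemma polys_single: "Poly_Mapping.keys t \<subseteq> {..<n} \<Longrightarrow> Poly_Mapping.single t c \<in> polys n"
  by (auto simp: polys_def)

section \<open>Degrees of monomials and homogeneous polynomials\<close>

lemma mon_deg_superset:
  assumes "finite A" "Poly_Mapping.keys t \<subseteq> A"
  shows "mon_deg t = (\<Sum>v\<in>A. Poly_Mapping.lookup t v)"
  unfolding mon_deg_def by (rule sum.mono_neutral_left) (use assms in \<open>auto simp: in_keys_iff\<close>)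

lemma mon_deg_add [simp]: "mon_deg (s + t) = mon_deg s + mon_deg t"
proof -
  let ?A = "Poly_Mapping.keys s \<union> Poly_Mapping.keys t"
  have "mon_deg (s + t) = (\<Sum>v\<in>?A. Poly_Mapping.lookup (s + t) v)"
    by (rule mon_deg_superset) (use keys_add[of s t] in auto)
  also have "\<dots> = mon_deg s + mon_deg t"
    by (simp add: lookup_add sum.distrib mon_deg_superset[of ?A s] mon_deg_superset[of ?A t])
  finally show ?thesis .
qed

lemma mon_deg_zero [simp]: "mon_deg 0 = 0"
  by (simp add: mon_deg_def)

lemma mon_deg_single [simp]: "mon_deg (Poly_Mapping.single v k) = k"
  by (simp add: mon_deg_def)

lemma mon_deg_eq_0_iff: "mon_deg t = 0 \<longleftrightarrow> t = 0"
  by (metis finite_keys in_keys_iff lookup_zero mon_deg_def mon_deg_zero poly_mapping_eqI sum_eq_0_iff)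

lemma homogeneous_zero [simp]: "homogeneous e 0"
  by (simp add: homogeneous_def)

lemma homogeneous_single: "int (mon_deg t) = e \<Longrightarrow> homogeneous e (Poly_Mapping.single t c)"
  by (simp add: homogeneous_def)

lemma homogeneous_add: "homogeneous e p \<Longrightarrow> homogeneous e q \<Longrightarrow> homogeneous e (p + q)"
  using keys_add[of p q] by (auto simp: homogeneous_def)

lemma homogeneous_uminus: "homogeneous e p \<Longrightarrow> homogeneous e (- p)"
  by (auto simp: homogeneous_def in_keys_iff)

lemma homogeneous_diff: "homogeneous e p \<Longrightarrow> homogeneous e q \<Longrightarrow> homogeneous e (p - q)"
  using homogeneous_add[of e p "- q"] homogeneous_uminus[of e q] by simp

lemma homogeneous_sum: "(\<And>i. i \<in> A \<Longrightarrow> homogeneous e (f i)) \<Longrightarrow> homogeneous e (\<Sum>i\<in>A. f i)"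
  by (induction A rule: infinite_finite_induct) (auto intro: homogeneous_add)

lemma homogeneous_mult:
  assumes "homogeneous d p" "homogeneous e q"
  shows "homogeneous (d + e) (p * q)"
  unfolding homogeneous_def
proof
  fix t assume "t \<in> Poly_Mapping.keys (p * q)"
  then obtain a b where "t = a + b" "a \<in> Poly_Mapping.keys p" "b \<in> Poly_Mapping.keys q"
    using subsetD[OF keys_mult[of p q]] by blast
  then show "int (mon_deg t) = d + e"
    using assms by (auto simp: homogeneous_def)
qed

lemma homogeneous_lookup_0: "homogeneous e p \<Longrightarrow> e \<noteq> 0 \<Longrightarrow> Poly_Mapping.lookup p 0 = 0"
  by (force simp: homogeneous_def in_keys_iff)

lemma homogeneous_neg: "homogeneous e p \<Longrightarrow> e < 0 \<Longrightarrow> p = 0"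
  by (rule poly_mapping_eqI) (force simp: homogeneous_def in_keys_iff)

lemma homogeneous_degree_0: "homogeneous 0 p \<Longrightarrow> Poly_Mapping.lookup p 0 = 0 \<Longrightarrow> p = 0"
  by (rule poly_mapping_eqI)
     (metis homogeneous_def in_keys_iff lookup_zero mon_deg_eq_0_iff of_nat_eq_0_iff)

definition hom_comp :: "int \<Rightarrow> 'k::field mpoly \<Rightarrow> 'k mpoly" where
  "hom_comp j p = Poly_Mapping.mapp (\<lambda>t c. c when int (mon_deg t) = j) p"

lemma lookup_hom_comp:
  "Poly_Mapping.lookup (hom_comp j p) t = (Poly_Mapping.lookup p t when int (mon_deg t) = j)"
  by (auto simp: hom_comp_def lookup_mapp in_keys_iff when_def)

lemma hom_comp_polys [simp]: "p \<in> polys n \<Longrightarrow> hom_comp j p \<in> polys n"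
  by (auto simp: polys_def in_keys_iff lookup_hom_comp)

lemma hom_comp_zero [simp]: "hom_comp j 0 = 0"
  by (rule poly_mapping_eqI) (simp add: lookup_hom_comp)

lemma hom_comp_add: "hom_comp j (p + q) = hom_comp j p + hom_comp j q"
  by (rule poly_mapping_eqI) (simp add: lookup_hom_comp lookup_add when_add_distrib)

lemma homogeneous_hom_comp [simp]: "homogeneous j (hom_comp j p)"
  by (auto simp: homogeneous_def in_keys_iff lookup_hom_comp)

lemma hom_comp_homogeneous: "homogeneous i p \<Longrightarrow> hom_comp j p = (if i = j then p else 0)"
  by (rule poly_mapping_eqI) (force simp: homogeneous_def in_keys_iff lookup_hom_comp when_def)

section \<open>Vectors over the polynomial ring and their homogeneous components\<close>

lemma lookup_vec_scale [simp]: "Poly_Mapping.lookup (vec_scale s v) b = s * Poly_Mapping.lookup v b"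
  by (simp add: vec_scale_def Poly_Mapping.map.rep_eq when_def)

lemma lookup_const_part [simp]:
  "Poly_Mapping.lookup (const_part v) b = Poly_Mapping.lookup (Poly_Mapping.lookup v b) 0"
  by (simp add: const_part_def Poly_Mapping.map.rep_eq when_def)

lemma vec_scale_simps [simp]: "vec_scale 0 v = 0" "vec_scale s 0 = 0" "vec_scale 1 v = v"
  by (auto intro!: poly_mapping_eqI)

lemma vec_scale_distribs:
  "vec_scale (s + t) v = vec_scale s v + vec_scale t v"
  "vec_scale s (v + w) = vec_scale s v + vec_scale s w"
  "vec_scale (s * t) v = vec_scale s (vec_scale t v)"
  by (auto intro!: poly_mapping_eqI simp: lookup_add algebra_simps)

lemma vec_scale_sum: "vec_scale s (\<Sum>i\<in>A. f i) = (\<Sum>i\<in>A. vec_scale s (f i))"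
  by (induction A rule: infinite_finite_induct) (auto simp: vec_scale_distribs)

lemma vec_scale_minus_one: "vec_scale (-1) v = - v"
  by (auto intro!: poly_mapping_eqI)

lemma free_module_iff:
  "v \<in> free_module n B \<longleftrightarrow> (\<forall>b. Poly_Mapping.lookup v b \<in> polys n \<and> (b \<notin> B \<longrightarrow> Poly_Mapping.lookup v b = 0))"
  by (auto simp: free_module_def in_keys_iff)

lemma free_module_closed [intro, simp]:
  "0 \<in> free_module n B"
  "v \<in> free_module n B \<Longrightarrow> w \<in> free_module n B \<Longrightarrow> v + w \<in> free_module n B"
  "v \<in> free_module n B \<Longrightarrow> w \<in> free_module n B \<Longrightarrow> v - w \<in> free_module n B"
  "s \<in> polys n \<Longrightarrow> v \<in> free_module n B \<Longrightarrow> vec_scale s v \<in> free_module n B"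
  "b \<in> B \<Longrightarrow> s \<in> polys n \<Longrightarrow> Poly_Mapping.single b s \<in> free_module n B"
  by (auto simp: free_module_iff lookup_add lookup_minus lookup_single when_def)

lemma free_module_sum: "(\<And>i. i \<in> A \<Longrightarrow> f i \<in> free_module n B) \<Longrightarrow> (\<Sum>i\<in>A. f i) \<in> free_module n B"
  by (induction A rule: infinite_finite_induct) auto

lemma vec_homogeneous_closed:
  "vec_homogeneous \<delta> j 0"
  "vec_homogeneous \<delta> j v \<Longrightarrow> vec_homogeneous \<delta> j w \<Longrightarrow> vec_homogeneous \<delta> j (v + w)"
  "vec_homogeneous \<delta> j v \<Longrightarrow> vec_homogeneous \<delta> j w \<Longrightarrow> vec_homogeneous \<delta> j (v - w)"
  "homogeneous e s \<Longrightarrow> vec_homogeneous \<delta> j v \<Longrightarrow> vec_homogeneous \<delta> (e + j) (vec_scale s v)"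
  by (auto simp: vec_homogeneous_def lookup_add lookup_minus homogeneous_add homogeneous_diff
      dest!: homogeneous_mult[of e s "j - \<delta> _"] simp: algebra_simps)

lemma vec_homogeneous_sum:
  "(\<And>i. i \<in> A \<Longrightarrow> vec_homogeneous \<delta> j (f i)) \<Longrightarrow> vec_homogeneous \<delta> j (\<Sum>i\<in>A. f i)"
  by (induction A rule: infinite_finite_induct) (auto intro: vec_homogeneous_closed)

lemma poly_mapping_eq_sum_single:
  assumes "finite A" "Poly_Mapping.keys v \<subseteq> A"
  shows "v = (\<Sum>b\<in>A. Poly_Mapping.single b (Poly_Mapping.lookup v b))"
  by (rule poly_mapping_eqI)
     (use assms in \<open>auto simp: lookup_sum lookup_single when_def in_keys_iff sum.delta\<close>)

definition vec_comp :: "(nat \<Rightarrow> int) \<Rightarrow> int \<Rightarrow> (nat \<Rightarrow>\<^sub>0 'k::field mpoly) \<Rightarrow> (nat \<Rightarrow>\<^sub>0 'k mpoly)" where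
  "vec_comp \<delta> j v = Poly_Mapping.mapp (\<lambda>b p. hom_comp (j - \<delta> b) p) v"

lemma lookup_vec_comp [simp]:
  "Poly_Mapping.lookup (vec_comp \<delta> j v) b = hom_comp (j - \<delta> b) (Poly_Mapping.lookup v b)"
  by (auto simp: vec_comp_def lookup_mapp in_keys_iff when_def)

lemma vec_comp_free_module [simp]: "v \<in> free_module n B \<Longrightarrow> vec_comp \<delta> j v \<in> free_module n B"
  by (auto simp: free_module_iff)

lemma vec_comp_add: "vec_comp \<delta> j (v + w) = vec_comp \<delta> j v + vec_comp \<delta> j w"
  by (rule poly_mapping_eqI) (simp add: lookup_add hom_comp_add)

lemma vec_comp_zero [simp]: "vec_comp \<delta> j 0 = 0"
  by (rule poly_mapping_eqI) simp

lemma vec_homogeneous_vec_comp [simp]: "vec_homogeneous \<delta> j (vec_comp \<delta> j v)"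
  by (simp add: vec_homogeneous_def)

lemma vec_comp_homogeneous:
  "vec_homogeneous \<delta> i v \<Longrightarrow> vec_comp \<delta> j v = (if i = j then v else 0)"
proof (rule poly_mapping_eqI)
  fix b assume "vec_homogeneous \<delta> i v"
  then have "homogeneous (i - \<delta> b) (Poly_Mapping.lookup v b)"
    by (simp add: vec_homogeneous_def)
  from hom_comp_homogeneous[OF this, of "j - \<delta> b"]
  show "Poly_Mapping.lookup (vec_comp \<delta> j v) b = Poly_Mapping.lookup (if i = j then v else 0) b"
    by simp
qed

lemma vec_eq_sum_comp:
  obtains J where "finite J" "v = (\<Sum>j\<in>J. vec_comp \<delta> j v)"
proof
  define J where "J = (\<Union>b\<in>Poly_Mapping.keys v.
    (\<lambda>t. int (mon_deg t) + \<delta> b) ` Poly_Mapping.keys (Poly_Mapping.lookup v b))"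
  show fin: "finite J" by (auto simp: J_def)
  show "v = (\<Sum>j\<in>J. vec_comp \<delta> j v)"
  proof (intro poly_mapping_eqI)
    fix b t
    let ?c = "Poly_Mapping.lookup (Poly_Mapping.lookup v b) t" and ?e = "int (mon_deg t) + \<delta> b"
    have "Poly_Mapping.lookup (Poly_Mapping.lookup (\<Sum>j\<in>J. vec_comp \<delta> j v) b) t =
      (\<Sum>j\<in>J. if j = ?e then ?c else 0)"
      by (simp add: lookup_sum lookup_hom_comp when_def algebra_simps eq_commute cong: if_cong)
    also have "\<dots> = ?c"
    proof (cases "?c = 0")
      case False
      then have "t \<in> Poly_Mapping.keys (Poly_Mapping.lookup v b)" "b \<in> Poly_Mapping.keys v"
        by (auto simp: in_keys_iff)
      then have "?e \<in> J" by (auto simp: J_def)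
      then show ?thesis using fin by simp
    qed (auto intro!: sum.neutral)
    finally show "?c = Poly_Mapping.lookup (Poly_Mapping.lookup (\<Sum>j\<in>J. vec_comp \<delta> j v) b) t" ..
  qed
qed

section \<open>Existence of graded free resolutions\<close>

lemma linear_map_zero:
  assumes "linear_map_on n (free_module n B) sc \<phi>"
  shows "\<phi> 0 = 0"
proof -
  have "\<phi> (0 + 0) = \<phi> 0 + \<phi> 0"
    using assms unfolding linear_map_on_def by blast
  then show ?thesis by simp
qed

lemma linear_map_sum:
  assumes "linear_map_on n (free_module n B) sc \<phi>" "\<And>i. i \<in> A \<Longrightarrow> f i \<in> free_module n B"
  shows "\<phi> (\<Sum>i\<in>A. f i) = (\<Sum>i\<in>A. \<phi> (f i))"
  using assms(2)
proof (induction A rule: infinite_finite_induct)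
  case (insert x A)
  then have "\<phi> (f x + sum f A) = \<phi> (f x) + \<phi> (sum f A)"
    using assms(1) free_module_sum[of A f n B] unfolding linear_map_on_def by blast
  with insert show ?case by simp
qed (use linear_map_zero[OF assms(1)] in auto)

lemma linear_map_diff:
  assumes "linear_map_on n (free_module n B) sc \<phi>" "v \<in> free_module n B" "w \<in> free_module n B"
  shows "\<phi> (v - w) = \<phi> v - \<phi> w"
proof -
  have "\<phi> ((v - w) + w) = \<phi> (v - w) + \<phi> w"
    using assms free_module_closed(3) unfolding linear_map_on_def by blast
  then show ?thesis by (simp add: algebra_simps)
qed

section \<open>Graded submodules and kernels\<close>

definition graded_submodule ::
  "nat \<Rightarrow> nat set \<Rightarrow> (nat \<Rightarrow> int) \<Rightarrow> (nat \<Rightarrow>\<^sub>0 'k::field mpoly) set \<Rightarrow> bool" where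
  "graded_submodule n B \<delta> Z \<longleftrightarrow> Z \<subseteq> free_module n B \<and> 0 \<in> Z \<and> (\<forall>v\<in>Z. \<forall>w\<in>Z. v + w \<in> Z) \<and>
     (\<forall>s\<in>polys n. \<forall>v\<in>Z. vec_scale s v \<in> Z) \<and> (\<forall>v\<in>Z. \<forall>j. vec_comp \<delta> j v \<in> Z)"

lemma graded_submodule_sum:
  assumes "graded_submodule n B \<delta> Z" "\<And>i. i \<in> A \<Longrightarrow> f i \<in> Z"
  shows "(\<Sum>i\<in>A. f i) \<in> Z"
  using assms(2) by (induction A rule: infinite_finite_induct) (use assms(1) in \<open>auto simp: graded_submodule_def\<close>)

lemma graded_submodule_diff:
  assumes "graded_submodule n B \<delta> Z" "v \<in> Z" "w \<in> Z"
  shows "v - w \<in> Z"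
proof -
  have "vec_scale (- 1) w \<in> Z"
    using assms unfolding graded_submodule_def by (meson polys_closed(2,4))
  then have "v + vec_scale (- 1) w \<in> Z"
    using assms unfolding graded_submodule_def by blast
  then show ?thesis by (simp add: vec_scale_minus_one)
qed

text \<open>Decompose \<open>v\<close> into finitely many components and apply \<open>hc\<close> to
  each image. The abstract \<open>hc\<close> takes components in the codomain, so one lemma serves
  the augmentation (\<open>hom_comp\<close>) and the boundary maps
  (\<open>vec_comp\<close>).\<close>

lemma linear_map_comp:
  fixes hc :: "int \<Rightarrow> 'b::ab_group_add \<Rightarrow> 'b"
  assumes lin: "linear_map_on n (free_module n B) sc \<phi>"
    and hc_add: "\<And>j x y. hc j (x + y) = hc j x + hc j y"
    and hc: "\<And>i j v. v \<in> free_module n B \<Longrightarrow> vec_homogeneous \<delta> i v \<Longrightarrow>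
               hc j (\<phi> v) = (if i = j then \<phi> v else 0)"
    and v: "v \<in> free_module n B"
  shows "\<phi> (vec_comp \<delta> j v) = hc j (\<phi> v)"
proof -
  have hc0: "hc j 0 = 0" for j using hc_add[of j 0 0] by simp
  have hc_sum: "hc j (\<Sum>i\<in>A. f i) = (\<Sum>i\<in>A. hc j (f i))" for j f and A :: "int set"
    by (induction A rule: infinite_finite_induct) (auto simp: hc0 hc_add)
  have vc_sum: "vec_comp \<delta> j (\<Sum>i\<in>A. f i) = (\<Sum>i\<in>A. vec_comp \<delta> j (f i))" for j f and A :: "int set"
    by (induction A rule: infinite_finite_induct) (auto simp: vec_comp_add)
  obtain J where J: "finite J" "v = (\<Sum>i\<in>J. vec_comp \<delta> i v)" by (rule vec_eq_sum_comp)
  have "hc j (\<phi> v) = hc j (\<phi> (\<Sum>i\<in>J. vec_comp \<delta> i v))" using J(2) by metis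
  also have "\<dots> = (\<Sum>i\<in>J. hc j (\<phi> (vec_comp \<delta> i v)))"
    using linear_map_sum[OF lin, of J "\<lambda>i. vec_comp \<delta> i v"] v by (simp add: hc_sum)
  also have "\<dots> = (\<Sum>i\<in>J. \<phi> (vec_comp \<delta> j (vec_comp \<delta> i v)))"
    using v by (intro sum.cong refl)
      (simp add: hc[OF _ vec_homogeneous_vec_comp] vec_comp_homogeneous[OF vec_homogeneous_vec_comp]
        linear_map_zero[OF lin])
  also have "\<dots> = \<phi> (\<Sum>i\<in>J. vec_comp \<delta> j (vec_comp \<delta> i v))"
    using v by (intro linear_map_sum[OF lin, symmetric]) auto
  also have "\<dots> = \<phi> (vec_comp \<delta> j (\<Sum>i\<in>J. vec_comp \<delta> i v))" by (simp add: vc_sum)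
  also have "\<dots> = \<phi> (vec_comp \<delta> j v)" using J(2) by metis
  finally show ?thesis by simp
qed

lemma graded_submodule_kernel:
  fixes hc :: "int \<Rightarrow> 'b::ab_group_add \<Rightarrow> 'b"
  assumes lin: "linear_map_on n (free_module n B) sc \<phi>"
    and sc: "\<And>s. sc s 0 = 0"
    and hc_add: "\<And>j x y. hc j (x + y) = hc j x + hc j y"
    and hc: "\<And>i j v. v \<in> free_module n B \<Longrightarrow> vec_homogeneous \<delta> i v \<Longrightarrow>
               hc j (\<phi> v) = (if i = j then \<phi> v else 0)"
  shows "graded_submodule n B \<delta> {v \<in> free_module n B. \<phi> v = 0}"
proof -
  have "hc j 0 = 0" for j using hc_add[of j 0 0] by simp
  with linear_map_comp[where hc = hc, OF lin hc_add hc] show ?thesis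
    using lin linear_map_zero[OF lin] unfolding graded_submodule_def linear_map_on_def
    by (auto simp: sc)
qed

section \<open>Covering a graded submodule by a free module\<close>

definition free_map :: "(nat \<Rightarrow> (nat \<Rightarrow>\<^sub>0 'k::field mpoly)) \<Rightarrow> (nat \<Rightarrow>\<^sub>0 'k mpoly) \<Rightarrow> (nat \<Rightarrow>\<^sub>0 'k mpoly)" where
  "free_map G w = (\<Sum>x\<in>Poly_Mapping.keys w. vec_scale (Poly_Mapping.lookup w x) (G x))"

lemma free_map_superset:
  assumes "finite A" "Poly_Mapping.keys w \<subseteq> A"
  shows "free_map G w = (\<Sum>x\<in>A. vec_scale (Poly_Mapping.lookup w x) (G x))"
  unfolding free_map_def by (rule sum.mono_neutral_left) (use assms in \<open>auto simp: in_keys_iff\<close>)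

lemma free_map_add: "free_map G (v + w) = free_map G v + free_map G w"
proof -
  let ?A = "Poly_Mapping.keys v \<union> Poly_Mapping.keys w"
  have "free_map G (v + w) = (\<Sum>x\<in>?A. vec_scale (Poly_Mapping.lookup (v + w) x) (G x))"
    by (rule free_map_superset) (use keys_add[of v w] in auto)
  also have "\<dots> = free_map G v + free_map G w"
    by (simp add: lookup_add vec_scale_distribs sum.distrib free_map_superset[of ?A v] free_map_superset[of ?A w])
  finally show ?thesis .
qed

lemma free_map_scale: "free_map G (vec_scale s w) = vec_scale s (free_map G w)"
proof -
  have "free_map G (vec_scale s w) =
    (\<Sum>x\<in>Poly_Mapping.keys w. vec_scale (Poly_Mapping.lookup (vec_scale s w) x) (G x))"
    by (rule free_map_superset) (auto simp: in_keys_iff)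
  then show ?thesis by (simp add: free_map_def vec_scale_sum vec_scale_distribs)
qed

lemma free_map_single: "free_map G (Poly_Mapping.single x s) = vec_scale s (G x)"
  using free_map_superset[of "{x}" "Poly_Mapping.single x s" G] by simp

lemma linear_map_on_free_map: "linear_map_on n F vec_scale (free_map G)"
  by (simp add: linear_map_on_def free_map_add free_map_scale)

text \<open>A finitely supported function is determined by its graph over the support, a finite
  subset of a countable set. Bases of a complex consist of natural numbers, so the terms of a free
  module have to be numbered.\<close>

lemma countable_poly_mapping: "countable (UNIV :: (nat \<Rightarrow>\<^sub>0 nat) set)"
proof -
  let ?g = "\<lambda>p :: nat \<Rightarrow>\<^sub>0 nat. (\<lambda>k. (k, Poly_Mapping.lookup p k)) ` Poly_Mapping.keys p"
  have "inj ?g"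
  proof (rule injI)
    fix p q assume eq: "?g p = ?g q"
    have "Poly_Mapping.lookup p k = Poly_Mapping.lookup q k" for k
    proof (cases "k \<in> Poly_Mapping.keys p \<or> k \<in> Poly_Mapping.keys q")
      case True
      then have "(k, Poly_Mapping.lookup p k) \<in> ?g q \<or> (k, Poly_Mapping.lookup q k) \<in> ?g p"
        using eq by (metis (mono_tags, lifting) imageI)
      then show ?thesis by auto
    qed (auto simp: in_keys_iff)
    then show "p = q" by (rule poly_mapping_eqI)
  qed
  moreover have "countable (range ?g)"
    by (rule countable_subset[OF _ countable_Collect_finite]) auto
  ultimately show ?thesis by (rule countable_image_inj_on[rotated])
qed

text \<open>
  Every term of the free module gets a number; a homogeneous generator is chosen for each leading
  term of \<open>Z\<close>, and Gaussian elimination shows that these countably many generators span \<open>Z\<close>.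
\<close>

lemma graded_submodule_cover:
  fixes Z :: "(nat \<Rightarrow>\<^sub>0 'k::field mpoly) set"
  assumes Z: "graded_submodule n B \<delta> Z"
  obtains B' \<delta>' \<phi> where "linear_map_on n (free_module n B') vec_scale \<phi>"
    "\<And>j v. v \<in> free_module n B' \<Longrightarrow> vec_homogeneous \<delta>' j v \<Longrightarrow> vec_homogeneous \<delta> j (\<phi> v)"
    "\<phi> ` free_module n B' = Z"
proof -
  define \<iota> :: "nat \<times> (nat \<Rightarrow>\<^sub>0 nat) \<Rightarrow> nat" where "\<iota> = to_nat_on UNIV"
  have "countable (UNIV :: (nat \<times> (nat \<Rightarrow>\<^sub>0 nat)) set)"
    using countable_SIGMA[of "UNIV :: nat set" "\<lambda>_. UNIV", OF _ countable_poly_mapping] by simp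
  then have inj: "inj \<iota>" unfolding \<iota>_def by (rule inj_on_to_nat_on)
  let ?lk = "\<lambda>(v :: nat \<Rightarrow>\<^sub>0 'k mpoly) \<tau>. Poly_Mapping.lookup (Poly_Mapping.lookup v (fst \<tau>)) (snd \<tau>)"
  \<comment> \<open>Terms are compared by their numbers alone, regardless of divisibility.
    Well-foundedness suffices, because the elimination below uses only scalars from the
    field.\<close>
  define lead where "lead v x \<longleftrightarrow> ?lk v (inv \<iota> x) \<noteq> 0 \<and> x \<in> range \<iota> \<and> (\<forall>\<tau>. ?lk v \<tau> \<noteq> 0 \<longrightarrow> \<iota> \<tau> \<le> x)" for v x
  \<comment> \<open>A homogeneous vector has the degree of any of its terms, so a basis element
    indexed by a leading term gets its degree before the vector is chosen.\<close>
  define deg where "deg x = int (mon_deg (snd (inv \<iota> x))) + \<delta> (fst (inv \<iota> x))" for x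
  have lead_deg: "j = deg x" if "lead v x" "vec_homogeneous \<delta> j v" for v x j
  proof -
    have "snd (inv \<iota> x) \<in> Poly_Mapping.keys (Poly_Mapping.lookup v (fst (inv \<iota> x)))"
      using that(1) by (simp add: lead_def in_keys_iff)
    then have "int (mon_deg (snd (inv \<iota> x))) = j - \<delta> (fst (inv \<iota> x))"
      using that(2) by (simp add: vec_homogeneous_def homogeneous_def)
    then show ?thesis by (simp add: deg_def)
  qed
  have lead_le: "\<iota> \<tau> \<le> x" if "lead v x" "?lk v \<tau> \<noteq> 0" for v x \<tau>
    using that(1)[unfolded lead_def, THEN conjunct2, THEN conjunct2, rule_format, OF that(2)] .
  have lead_ex: "\<exists>x. lead v x" if "v \<noteq> 0" for v
  proof -
    let ?T = "{\<tau>. ?lk v \<tau> \<noteq> 0}"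
    have "?T \<subseteq> Sigma (Poly_Mapping.keys v) (\<lambda>b. Poly_Mapping.keys (Poly_Mapping.lookup v b))"
      by (auto simp: in_keys_iff)
    then have fin: "finite ?T" by (rule finite_subset) auto
    have "?T \<noteq> {}"
    proof
      assume "?T = {}"
      then have "Poly_Mapping.lookup (Poly_Mapping.lookup v b) t = 0" for b t by force
      then have "v = 0" by (auto intro!: poly_mapping_eqI)
      with that show False by simp
    qed
    then have "Max (\<iota> ` ?T) \<in> \<iota> ` ?T" using fin by (intro Max_in) auto
    then obtain \<tau> where \<tau>: "Max (\<iota> ` ?T) = \<iota> \<tau>" "?lk v \<tau> \<noteq> 0" by auto
    have le: "\<iota> \<tau>' \<le> \<iota> \<tau>" if "?lk v \<tau>' \<noteq> 0" for \<tau>'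
      unfolding \<tau>(1)[symmetric] by (rule Max_ge) (use fin that in auto)
    then have "lead v (\<iota> \<tau>)"
      unfolding lead_def inv_f_f[OF inj] using \<tau>(2) le by blast
    then show ?thesis ..
  qed
  define B' where "B' = {x. \<exists>v\<in>Z. vec_homogeneous \<delta> (deg x) v \<and> lead v x}"
  define G where "G x = (SOME v. v \<in> Z \<and> vec_homogeneous \<delta> (deg x) v \<and> lead v x)" for x
  have G: "G x \<in> Z" "vec_homogeneous \<delta> (deg x) (G x)" "lead (G x) x" if "x \<in> B'" for x
    using someI_ex[of "\<lambda>v. v \<in> Z \<and> vec_homogeneous \<delta> (deg x) v \<and> lead v x"] that
    unfolding G_def[symmetric] B'_def by blast+
  let ?\<phi> = "free_map G"
  have lin: "linear_map_on n (free_module n B') vec_scale ?\<phi>" by (rule linear_map_on_free_map)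
  have hom: "vec_homogeneous \<delta> j (?\<phi> v)" if "v \<in> free_module n B'" "vec_homogeneous deg j v" for j v
    unfolding free_map_def
  proof (rule vec_homogeneous_sum)
    fix x assume "x \<in> Poly_Mapping.keys v"
    then have "x \<in> B'" using that(1) by (auto simp: free_module_def)
    moreover have "homogeneous (j - deg x) (Poly_Mapping.lookup v x)"
      using that(2) by (simp add: vec_homogeneous_def)
    ultimately have "vec_homogeneous \<delta> (j - deg x + deg x) (vec_scale (Poly_Mapping.lookup v x) (G x))"
      using vec_homogeneous_closed(4) G(2) by blast
    then show "vec_homogeneous \<delta> j (vec_scale (Poly_Mapping.lookup v x) (G x))" by simp
  qed
  have "?\<phi> w \<in> Z" if "w \<in> free_module n B'" for w
    unfolding free_map_def
    by (rule graded_submodule_sum[OF Z]) (use that Z G(1) in \<open>auto simp: graded_submodule_def free_module_def\<close>)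
  moreover have hom_span: "v \<in> ?\<phi> ` free_module n B'"
    if "v \<in> Z" "vec_homogeneous \<delta> j v" "\<forall>\<tau>. ?lk v \<tau> \<noteq> 0 \<longrightarrow> \<iota> \<tau> < N" for v j N
    using that
  proof (induction N arbitrary: v rule: less_induct)
    case (less N)
    show ?case
    proof (cases "v = 0")
      case True
      have "?\<phi> 0 = 0" by (simp add: free_map_def)
      with True show ?thesis by (metis free_module_closed(1) imageI)
    next
      case False
      then obtain x where x: "lead v x" using lead_ex by blast
      then have j: "j = deg x" using lead_deg less by blast
      have xB: "x \<in> B'" using x less j by (auto simp: B'_def)
      let ?\<tau> = "inv \<iota> x"
      \<comment> \<open>This scalar matches the leading coefficients, so \<open>v'\<close> keeps its
        degree and has only terms with numbers below \<open>x\<close>.\<close>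
      define c where "c = Poly_Mapping.single (0 :: nat \<Rightarrow>\<^sub>0 nat) (?lk v ?\<tau> / ?lk (G x) ?\<tau>)"
      have c: "c \<in> polys n" unfolding c_def by (rule polys_single) simp
      have lkc: "?lk (vec_scale c w) \<tau> = ?lk v ?\<tau> / ?lk (G x) ?\<tau> * ?lk w \<tau>" for w \<tau>
        by (simp add: c_def Poly_Mapping.map.rep_eq when_def flip: mult_map_scale_conv_mult)
      define v' where "v' = v - vec_scale c (G x)"
      have lk': "?lk v' \<tau> = ?lk v \<tau> - ?lk v ?\<tau> / ?lk (G x) ?\<tau> * ?lk (G x) \<tau>" for \<tau>
        unfolding v'_def by (simp only: lookup_minus lkc)
      have x0: "?lk v ?\<tau> \<noteq> 0" "?lk (G x) ?\<tau> \<noteq> 0" "\<iota> ?\<tau> = x"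
        using x G(3)[OF xB] f_inv_into_f[of x \<iota> UNIV] by (auto simp: lead_def)
      have v'Z: "v' \<in> Z"
        unfolding v'_def using less(2) G(1)[OF xB] c Z
        by (intro graded_submodule_diff[OF Z]) (auto simp: graded_submodule_def)
      have v'h: "vec_homogeneous \<delta> j v'"
      proof -
        have "homogeneous 0 c" unfolding c_def by (rule homogeneous_single) simp
        then have "vec_homogeneous \<delta> (0 + j) (vec_scale c (G x))"
          using G(2)[OF xB] unfolding j by (rule vec_homogeneous_closed(4))
        then show ?thesis unfolding v'_def using less(3) by (simp add: vec_homogeneous_closed(3))
      qed
      have "\<forall>\<tau>. ?lk v' \<tau> \<noteq> 0 \<longrightarrow> \<iota> \<tau> < x"
      proof (intro allI impI)
        fix \<tau> assume nz: "?lk v' \<tau> \<noteq> 0"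
        then have "\<tau> \<noteq> ?\<tau>" unfolding lk' using x0 by auto
        then have "\<iota> \<tau> \<noteq> x" using x0 inj by (metis inv_f_f)
        moreover have "?lk v \<tau> \<noteq> 0 \<or> ?lk (G x) \<tau> \<noteq> 0" using nz unfolding lk' by auto
        then have "\<iota> \<tau> \<le> x" using lead_le[OF x] lead_le[OF G(3)[OF xB]] by blast
        ultimately show "\<iota> \<tau> < x" by simp
      qed
      moreover have "x < N" using less(4)[rule_format, OF x0(1)] x0(3) by simp
      ultimately have "v' \<in> ?\<phi> ` free_module n B'" using less(1) v'Z v'h by blast
      then obtain w where w: "w \<in> free_module n B'" "v' = ?\<phi> w" by blast
      have "v = ?\<phi> (w + Poly_Mapping.single x c)"
        by (simp add: free_map_add free_map_single flip: w(2)) (simp add: v'_def)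
      moreover have "w + Poly_Mapping.single x c \<in> free_module n B'" using w(1) xB c by auto
      ultimately show ?thesis by blast
    qed
  qed
  have "v \<in> ?\<phi> ` free_module n B'" if v: "v \<in> Z" for v
  proof -
    obtain J where J: "finite J" "v = (\<Sum>j\<in>J. vec_comp \<delta> j v)" by (rule vec_eq_sum_comp)
    have "vec_comp \<delta> j v \<in> ?\<phi> ` free_module n B'" for j
    proof (cases "vec_comp \<delta> j v = 0")
      case True
      have "?\<phi> 0 = 0" by (simp add: free_map_def)
      with True show ?thesis by (metis free_module_closed(1) imageI)
    next
      case False
      then obtain x where "lead (vec_comp \<delta> j v) x" using lead_ex by blast
      then have "\<forall>\<tau>. ?lk (vec_comp \<delta> j v) \<tau> \<noteq> 0 \<longrightarrow> \<iota> \<tau> < Suc x" using lead_le by (simp add: less_Suc_eq_le)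
      moreover have "vec_comp \<delta> j v \<in> Z" using v Z by (simp add: graded_submodule_def)
      ultimately show ?thesis using hom_span[OF _ vec_homogeneous_vec_comp] by blast
    qed
    then obtain w where w: "\<And>j. w j \<in> free_module n B'" "\<And>j. vec_comp \<delta> j v = ?\<phi> (w j)"
      unfolding image_iff by metis
    have "v = ?\<phi> (\<Sum>j\<in>J. w j)"
    proof -
      have "v = (\<Sum>j\<in>J. ?\<phi> (w j))" unfolding w(2)[symmetric] by (rule J(2))
      then show ?thesis using linear_map_sum[OF lin, of J w] w(1) by simp
    qed
    then show ?thesis using w(1) by (auto intro!: imageI free_module_sum)
  qed
  ultimately have "?\<phi> ` free_module n B' = Z" by blast
  with that[OF lin hom] show ?thesis by blast
qed

lemma graded_free_resolution_exists:
  fixes \<phi> :: "(nat \<Rightarrow>\<^sub>0 'k::field mpoly) \<Rightarrow> 'k mpoly"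
  assumes lin: "linear_map_on n (free_module n B) (*) \<phi>"
    and hom: "\<And>j v. v \<in> free_module n B \<Longrightarrow> vec_homogeneous \<delta> j v \<Longrightarrow> homogeneous j (\<phi> v)"
  obtains C where "graded_free_resolution n (\<phi> ` free_module n B) C"
    "basis C 0 = B" "shift C 0 = \<delta>" "augm C = \<phi>"
proof -
  \<comment> \<open>A state consists of a basis, its degrees, the map to the previous module, and a
    submodule still to be covered. The second state covers the submodule of the first and passes on
    its own kernel.\<close>
  define Q where "Q x y \<longleftrightarrow> (case (x, y) of ((B, \<delta>, \<psi>, Z), (B', \<delta>', \<psi>', Z')) \<Rightarrow>
      linear_map_on n (free_module n B') vec_scale \<psi>' \<and>
      (\<forall>j. \<forall>v \<in> free_module n B'. vec_homogeneous \<delta>' j v \<longrightarrow> vec_homogeneous \<delta> j (\<psi>' v)) \<and>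
      \<psi>' ` free_module n B' = Z \<and> Z' = {v \<in> free_module n B'. \<psi>' v = 0})"
    for x y :: "nat set \<times> (nat \<Rightarrow> int) \<times> ((nat \<Rightarrow>\<^sub>0 'k mpoly) \<Rightarrow> (nat \<Rightarrow>\<^sub>0 'k mpoly)) \<times> (nat \<Rightarrow>\<^sub>0 'k mpoly) set"
  define P where "P i x \<longleftrightarrow> (case x of (B', \<delta>', \<psi>, Z) \<Rightarrow> graded_submodule n B' \<delta>' Z \<and>
      (i = (0::nat) \<longrightarrow> B' = B \<and> \<delta>' = \<delta> \<and> Z = {v \<in> free_module n B. \<phi> v = 0}))"
    for i and x :: "nat set \<times> (nat \<Rightarrow> int) \<times> ((nat \<Rightarrow>\<^sub>0 'k mpoly) \<Rightarrow> (nat \<Rightarrow>\<^sub>0 'k mpoly)) \<times> (nat \<Rightarrow>\<^sub>0 'k mpoly) set"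
  have "graded_submodule n B \<delta> {v \<in> free_module n B. \<phi> v = 0}"
    by (rule graded_submodule_kernel[where hc = hom_comp, OF lin])
       (simp_all add: hom_comp_add hom_comp_homogeneous[OF hom])
  \<comment> \<open>\<open>id\<close> is a placeholder: at stage 0 there is no boundary map, and the
    map out of the module is the augmentation.\<close>
  then have "P 0 (B, \<delta>, id, {v \<in> free_module n B. \<phi> v = 0})" by (simp add: P_def)
  then have start: "\<exists>x. P 0 x" ..
  have step: "\<exists>y. P (Suc i) y \<and> Q x y" if "P i x" for i x
  proof -
    obtain B1 \<delta>1 \<psi>1 Z1 where x: "x = (B1, \<delta>1, \<psi>1, Z1)" by (cases x)
    with that have "graded_submodule n B1 \<delta>1 Z1" by (simp add: P_def)
    then obtain B' \<delta>' \<psi> where *: "linear_map_on n (free_module n B') vec_scale \<psi>"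
      "\<And>j v. v \<in> free_module n B' \<Longrightarrow> vec_homogeneous \<delta>' j v \<Longrightarrow> vec_homogeneous \<delta>1 j (\<psi> v)"
      "\<psi> ` free_module n B' = Z1"
    proof (rule graded_submodule_cover)
      fix B' \<delta>' \<psi>
      assume "linear_map_on n (free_module n B') vec_scale \<psi>"
        "\<And>j v. v \<in> free_module n B' \<Longrightarrow> vec_homogeneous \<delta>' j v \<Longrightarrow> vec_homogeneous \<delta>1 j (\<psi> v)"
        "\<psi> ` free_module n B' = Z1"
      then show thesis by (rule that)
    qed
    have "graded_submodule n B' \<delta>' {v \<in> free_module n B'. \<psi> v = 0}"
      by (rule graded_submodule_kernel[where hc = "vec_comp \<delta>1", OF *(1)])
         (simp_all add: vec_comp_add vec_comp_homogeneous[OF *(2)])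
    then have "P (Suc i) (B', \<delta>', \<psi>, {v \<in> free_module n B'. \<psi> v = 0}) \<and>
        Q x (B', \<delta>', \<psi>, {v \<in> free_module n B'. \<psi> v = 0})"
      using * by (simp add: P_def Q_def x)
    then show ?thesis by blast
  qed
  obtain h where "\<forall>i. P i (h i) \<and> Q (h i) (h (Suc i))"
    using dependent_nat_choice[of P "\<lambda>_. Q", OF start step] by blast
  then have h: "\<And>i. P i (h i)" "\<And>i. Q (h i) (h (Suc i))" by blast+
  define hB h\<delta> h\<psi> hZ where "hB i = fst (h i)" and "h\<delta> i = fst (snd (h i))"
    and "h\<psi> i = fst (snd (snd (h i)))" and "hZ i = snd (snd (snd (h i)))" for i
  have h_eq: "h i = (hB i, h\<delta> i, h\<psi> i, hZ i)" for i
    by (simp add: hB_def h\<delta>_def h\<psi>_def hZ_def)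
  have h0: "hB 0 = B" "h\<delta> 0 = \<delta>" "hZ 0 = {v \<in> free_module n B. \<phi> v = 0}"
    using h(1)[of 0] unfolding h_eq P_def by simp_all
  have Q: "linear_map_on n (free_module n (hB (Suc i))) vec_scale (h\<psi> (Suc i))"
    "\<forall>j. \<forall>v \<in> free_module n (hB (Suc i)).
       vec_homogeneous (h\<delta> (Suc i)) j v \<longrightarrow> vec_homogeneous (h\<delta> i) j (h\<psi> (Suc i) v)"
    "h\<psi> (Suc i) ` free_module n (hB (Suc i)) = hZ i"
    "hZ (Suc i) = {v \<in> free_module n (hB (Suc i)). h\<psi> (Suc i) v = 0}" for i
    using h(2)[of i] unfolding h_eq Q_def by simp_all
  define C where "C = \<lparr>basis = hB, shift = h\<delta>, bdry = \<lambda>i. h\<psi> (Suc i), augm = \<phi>\<rparr>"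
  have C0: "basis C 0 = B" "shift C 0 = \<delta>" "augm C = \<phi>" by (simp_all add: C_def h0)
  have "graded_free_resolution n (\<phi> ` free_module n B) C"
    unfolding graded_free_resolution_def module_at_def
    using Q Q(3)[of 0] lin hom by (simp add: C_def h0)
  from that[OF this C0] show ?thesis .
qed

section \<open>Regularity and first syzygies\<close>

text \<open>
  A homogeneous syzygy of least degree outside \<open>U\<close> is not in \<open>S\<^sub>+\<close> times the syzygy module, so it
  contributes to \<open>Tor\<^sub>1\<close>.
\<close>

lemma regularity_ge_of_syzygy:
  fixes f :: "nat \<Rightarrow> 'k::field mpoly" and m n :: nat
  defines "syz \<equiv> {v \<in> free_module n {..<m}. (\<Sum>i<m. Poly_Mapping.lookup v i * f i) = 0}"
  assumes polys: "\<And>i. i < m \<Longrightarrow> f i \<in> polys n" and hom: "\<And>i. i < m \<Longrightarrow> homogeneous (int d) (f i)"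
    and U0: "0 \<in> U" and U_add: "\<And>v w. v \<in> U \<Longrightarrow> w \<in> U \<Longrightarrow> v + w \<in> U"
    and U_scale: "\<And>s v. s \<in> polys n \<Longrightarrow> v \<in> U \<Longrightarrow> vec_scale s v \<in> U"
    and small: "\<And>v e. v \<in> syz \<Longrightarrow> vec_homogeneous (\<lambda>_. 0) (int e) v \<Longrightarrow> e < Y \<Longrightarrow> v \<in> U"
    and v0: "v0 \<in> syz" "v0 \<notin> U" and "Y > 0"
  shows "ereal (real d + real Y - 1) \<le> regularity n (generated_ideal n m f)"
proof -
  define \<phi> where "\<phi> v = (\<Sum>i<m. Poly_Mapping.lookup v i * f i)" for v
  let ?F = "free_module n {..<m}" and ?\<delta> = "\<lambda>_::nat. int d"
  have lin: "linear_map_on n ?F (*) \<phi>"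
    by (auto simp: linear_map_on_def \<phi>_def lookup_add algebra_simps sum.distrib sum_distrib_left)
  have \<phi>hom: "homogeneous j (\<phi> v)" if "vec_homogeneous ?\<delta> j v" for j v
    unfolding \<phi>_def
  proof (rule homogeneous_sum)
    fix i assume i: "i \<in> {..<m}"
    have "homogeneous (j - int d + int d) (Poly_Mapping.lookup v i * f i)"
      by (rule homogeneous_mult) (use that i hom in \<open>auto simp: vec_homogeneous_def\<close>)
    then show "homogeneous j (Poly_Mapping.lookup v i * f i)" by simp
  qed
  have img: "\<phi> ` ?F = generated_ideal n m f"
  proof (intro set_eqI iffI)
    fix p assume "p \<in> \<phi> ` ?F"
    then show "p \<in> generated_ideal n m f"
      by (auto simp: \<phi>_def generated_ideal_def free_module_iff)
  next
    fix p assume "p \<in> generated_ideal n m f"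
    then obtain a where a: "p = (\<Sum>i<m. a i * f i)" "\<forall>i<m. a i \<in> polys n"
      by (auto simp: generated_ideal_def)
    let ?v = "\<Sum>i<m. Poly_Mapping.single i (a i)"
    have "Poly_Mapping.lookup ?v i = a i" if "i < m" for i
      using that by (simp add: lookup_sum lookup_single when_def)
    then have "p = \<phi> ?v" by (simp add: \<phi>_def a(1))
    moreover have "?v \<in> ?F" by (rule free_module_sum) (use a(2) in auto)
    ultimately show "p \<in> \<phi> ` ?F" by blast
  qed
  obtain C where C: "graded_free_resolution n (generated_ideal n m f) C"
    "basis C 0 = {..<m}" "shift C 0 = ?\<delta>" "augm C = \<phi>"
    using graded_free_resolution_exists[OF lin \<phi>hom] img by metis
  let ?F1 = "free_module n (basis C 1)" and ?F2 = "free_module n (basis C 2)"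
  let ?b0 = "bdry C 0" and ?b1 = "bdry C 1"
  have lin_b: "linear_map_on n (free_module n (basis C (Suc i))) vec_scale (bdry C i)"
    and hom_b: "\<And>j v. v \<in> free_module n (basis C (Suc i)) \<Longrightarrow>
       vec_homogeneous (shift C (Suc i)) j v \<Longrightarrow> vec_homogeneous (shift C i) j (bdry C i v)"
    and img0: "?b0 ` ?F1 = syz"
    and img_b: "bdry C (Suc i) ` free_module n (basis C (Suc (Suc i))) =
       {v \<in> free_module n (basis C (Suc i)). bdry C i v = 0}" for i
    using C(1) unfolding graded_free_resolution_def module_at_def C(2-4) syz_def \<phi>_def by blast+
  note lin0 = lin_b[of 0, folded One_nat_def]
    and hom0 = hom_b[of _ 0, unfolded C(3), folded One_nat_def]
    and hom1 = hom_b[of _ 1, unfolded Suc_1]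
  have img1: "?b1 ` ?F2 = {v \<in> ?F1. ?b0 v = 0}"
    using img_b[of 0] by (simp add: numeral_2_eq_2)
  have syz: "graded_submodule n {..<m} (\<lambda>_. 0) syz"
  proof -
    have "graded_submodule n {..<m} ?\<delta> syz" unfolding syz_def \<phi>_def[symmetric]
      by (rule graded_submodule_kernel[where hc = hom_comp, OF lin])
         (simp_all add: hom_comp_add hom_comp_homogeneous[OF \<phi>hom])
    \<comment> \<open>A syzygy of degree \<open>j + d\<close> in the first module has coordinates of
      degree \<open>j\<close>, so the two gradings differ only in the numbering of
      components.\<close>
    moreover have "vec_comp (\<lambda>_. 0) j v = vec_comp ?\<delta> (j + int d) v" for j and v :: "nat \<Rightarrow>\<^sub>0 'k mpoly"
      by (rule poly_mapping_eqI) simp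
    ultimately show ?thesis unfolding graded_submodule_def by simp
  qed
  have shift: "vec_homogeneous ?\<delta> j v \<longleftrightarrow> vec_homogeneous (\<lambda>_. 0) (j - int d) v" for j and v :: "nat \<Rightarrow>\<^sub>0 'k mpoly"
    by (simp add: vec_homogeneous_def)
  have neg: "v \<in> U" if "vec_homogeneous (\<lambda>_. 0) j v" "j < 0" for j v
  proof -
    have "v = 0"
      by (rule poly_mapping_eqI) (use that homogeneous_neg in \<open>auto simp: vec_homogeneous_def\<close>)
    then show ?thesis using U0 by simp
  qed
  have U_sum: "(\<Sum>i\<in>A. g i) \<in> U" if "\<And>i. i \<in> A \<Longrightarrow> g i \<in> U" for A :: "int set" and g
    using that by (induction A rule: infinite_finite_induct) (auto intro: U0 U_add)
  have U_sum': "(\<Sum>i\<in>A. g i) \<in> U" if "\<And>i. i \<in> A \<Longrightarrow> g i \<in> U" for A :: "nat set" and g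
    using that by (induction A rule: infinite_finite_induct) (auto intro: U0 U_add)
  define P where "P e \<longleftrightarrow> (\<exists>v\<in>syz. vec_homogeneous (\<lambda>_. 0) (int e) v \<and> v \<notin> U)" for e
  \<comment> \<open>Otherwise every component of \<open>v0\<close> would lie in \<open>U\<close>
    (those of negative degree are 0), and with them \<open>v0\<close>.\<close>
  have "\<exists>e. P e"
  proof (rule ccontr)
    assume nP: "\<nexists>e. P e"
    obtain J where J: "finite J" "v0 = (\<Sum>j\<in>J. vec_comp (\<lambda>_. 0) j v0)" by (rule vec_eq_sum_comp)
    have "vec_comp (\<lambda>_. 0) j v0 \<in> U" for j
    proof (cases "j < 0")
      case False
      then have j: "j = int (nat j)" by simp
      have "vec_comp (\<lambda>_. 0) j v0 \<in> syz" using v0 syz by (simp add: graded_submodule_def)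
      moreover have "vec_homogeneous (\<lambda>_. 0) (int (nat j)) (vec_comp (\<lambda>_. 0) j v0)"
        using j by simp
      ultimately show ?thesis using nP unfolding P_def by blast
    qed (use neg vec_homogeneous_vec_comp in blast)
    then have "(\<Sum>j\<in>J. vec_comp (\<lambda>_. 0) j v0) \<in> U" by (intro U_sum)
    with J(2) v0(2) show False by simp
  qed
  define e where "e = (LEAST e. P e)"
  have "P e" unfolding e_def by (rule LeastI_ex) fact
  then obtain v where v: "v \<in> syz" "vec_homogeneous (\<lambda>_. 0) (int e) v" "v \<notin> U"
    by (auto simp: P_def)
  have eY: "e \<ge> Y" using small v by (meson not_le)
  have below: "w \<in> U" if "w \<in> syz" "vec_homogeneous (\<lambda>_. 0) j w" "j < int e" for w j
  proof (cases "j < 0")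
    case False
    then have "\<not> P (nat j)" using that(3) unfolding e_def by (intro not_less_Least) simp
    then show ?thesis using that False by (auto simp: P_def)
  qed (use neg that in blast)
  let ?j = "int d + int e"
  have vj: "vec_homogeneous ?\<delta> ?j v" using v(2) by (simp add: shift)
  obtain w0 where w0: "w0 \<in> ?F1" "?b0 w0 = v" using v(1) img0 by blast
  \<comment> \<open>A preimage of \<open>v\<close> need not be homogeneous, but its component of
    degree \<open>?j\<close> is again a preimage.\<close>
  define w where "w = vec_comp (shift C 1) ?j w0"
  have w: "w \<in> ?F1" "vec_homogeneous (shift C 1) ?j w" using w0 by (auto simp: w_def)
  have "?b0 w = vec_comp ?\<delta> ?j (?b0 w0)" unfolding w_def
    by (rule linear_map_comp[where hc = "vec_comp ?\<delta>", OF lin0 vec_comp_add _ w0(1)])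
       (simp add: vec_comp_homogeneous[OF hom0])
  then have b0w: "?b0 w = v" using vj by (simp add: w0 vec_comp_homogeneous)
  \<comment> \<open>Since \<open>e >= Y > 0\<close>, the coordinates of \<open>v\<close> have no
    constant term; hence \<open>w\<close> gives a cycle after tensoring with the field.\<close>
  have "const_part v = 0"
    by (rule poly_mapping_eqI)
       (use v(2) eY \<open>Y > 0\<close> in \<open>auto simp: vec_homogeneous_def intro!: homogeneous_lookup_0[of "int e"]\<close>)
  then have cyc: "const_part w \<in> tor_cycles n C 1 ?j"
    using w b0w by (auto simp: tor_cycles_def module_at_def)
  \<comment> \<open>An argument in the style of Nakayama: subtracting a boundary would leave a
    preimage of \<open>v\<close> whose coordinates have no constant term. Then \<open>v\<close>
    would be a combination of images of basis elements of smaller degree, which lie in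
    \<open>U\<close> by minimality of \<open>e\<close>.\<close>
  have "const_part w \<notin> tor_boundaries n C 1 ?j"
  proof
    assume "const_part w \<in> tor_boundaries n C 1 ?j"
    then obtain x where x: "const_part w = const_part (?b1 x)" "x \<in> ?F2" "vec_homogeneous (shift C 2) ?j x"
      by (auto simp: tor_boundaries_def module_at_def numeral_2_eq_2)
    define y where "y = w - ?b1 x"
    have "?b1 x \<in> {v \<in> ?F1. ?b0 v = 0}" using imageI[OF x(2), of ?b1] unfolding img1 .
    then have b1x: "?b1 x \<in> ?F1" "?b0 (?b1 x) = 0" by simp_all
    have y: "y \<in> ?F1" "vec_homogeneous (shift C 1) ?j y" "?b0 y = v"
      using w b1x hom1[OF x(2,3)] b0w
      by (auto simp: y_def linear_map_diff[OF lin0] intro!: vec_homogeneous_closed(3))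
    have y0: "Poly_Mapping.lookup (Poly_Mapping.lookup y b) 0 = 0" for b
      using x(1) unfolding y_def lookup_minus by (metis lookup_const_part right_minus_eq)
    have e_in: "Poly_Mapping.single b 1 \<in> ?F1" if "b \<in> Poly_Mapping.keys y" for b
      using that y(1) by (intro free_module_closed(5)) (auto simp: free_module_def)
    have y_poly: "Poly_Mapping.lookup y b \<in> polys n" for b
      using y(1) by (simp add: free_module_def)
    have y_term: "vec_scale (Poly_Mapping.lookup y b) (?b0 (Poly_Mapping.single b 1)) \<in> U"
      if b: "b \<in> Poly_Mapping.keys y" for b
    proof (rule U_scale)
      let ?p = "Poly_Mapping.lookup y b" and ?e = "Poly_Mapping.single b 1"
      show "?p \<in> polys n" by (rule y_poly)
      have p: "?p \<noteq> 0" "homogeneous (?j - shift C 1 b) ?p"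
        using b y(2) by (auto simp: in_keys_iff vec_homogeneous_def)
      have "?j - shift C 1 b \<noteq> 0" using homogeneous_degree_0[OF _ y0] p by metis
      moreover have "\<not> ?j - shift C 1 b < 0" using homogeneous_neg[OF p(2)] p(1) by blast
      ultimately have lt: "shift C 1 b - int d < int e" by simp
      note eb = e_in[OF b]
      have "vec_homogeneous (shift C 1) (shift C 1 b) ?e"
        by (auto simp: vec_homogeneous_def lookup_single when_def homogeneous_def)
      then have "vec_homogeneous (\<lambda>_. 0) (shift C 1 b - int d) (?b0 ?e)"
        using hom0[OF eb] shift by blast
      then show "?b0 ?e \<in> U" using below lt eb img0 by blast
    qed
    have "v = ?b0 (\<Sum>b\<in>Poly_Mapping.keys y. vec_scale (Poly_Mapping.lookup y b) (Poly_Mapping.single b 1))"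
    proof -
      have "vec_scale p (Poly_Mapping.single b 1) = Poly_Mapping.single b p" for p :: "'k mpoly" and b
        by (rule poly_mapping_eqI) (simp add: lookup_single when_def)
      then show ?thesis using poly_mapping_eq_sum_single[of "Poly_Mapping.keys y" y] y(3) by simp
    qed
    also have "\<dots> = (\<Sum>b\<in>Poly_Mapping.keys y. ?b0 (vec_scale (Poly_Mapping.lookup y b) (Poly_Mapping.single b 1)))"
      using e_in y_poly by (intro linear_map_sum[OF lin0]) auto
    also have "\<dots> = (\<Sum>b\<in>Poly_Mapping.keys y. vec_scale (Poly_Mapping.lookup y b) (?b0 (Poly_Mapping.single b 1)))"
      using e_in y_poly lin0 unfolding linear_map_on_def by (intro sum.cong refl) blast
    also have "\<dots> \<in> U" by (rule U_sum') (rule y_term)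
    finally show False using v(3) by blast
  qed
  with cyc C(1) have "tor_nonzero n (generated_ideal n m f) 1 ?j"
    unfolding tor_nonzero_def by blast
  then have "ereal (real_of_int (?j - int 1)) \<le> regularity n (generated_ideal n m f)"
    unfolding regularity_def by (intro Sup_upper) blast
  moreover have "ereal (real d + real Y - 1) \<le> ereal (real_of_int (?j - int 1))"
    using eY by simp
  ultimately show ?thesis by (rule order_trans[rotated])
qed

section \<open>A commutative rewriting system computing repeated squares\<close>

datatype idx = I1 | I2 | I3 | I4

text \<open>\<open>vS d\<close> and \<open>vF d\<close> mark the start and the end of the routine of
  level \<open>d\<close>; \<open>vC d i\<close> selects one of its four counters, and
  \<open>vB d i\<close> is a unit of that counter. \<open>vZ\<close> homogenizes, and
  \<open>vU\<close>, \<open>vV\<close> serve to pack all quintics into one form.\<close>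

datatype var = vZ | vU | vV | vS nat | vF nat | vC nat idx | vB nat idx

instance idx :: countable by countable_datatype
instance var :: countable by countable_datatype

lemma all_idx: "(\<forall>i. P i) \<longleftrightarrow> P I1 \<and> P I2 \<and> P I3 \<and> P I4"
  by (metis idx.exhaust)

definition mv :: "var \<Rightarrow> nat \<Rightarrow> (nat \<Rightarrow>\<^sub>0 nat)" where
  "mv x k = Poly_Mapping.single (to_nat x) k"

definition expo :: "(nat \<Rightarrow>\<^sub>0 nat) \<Rightarrow> var \<Rightarrow> nat" where
  "expo m x = Poly_Mapping.lookup m (to_nat x)"

definition mon :: "var list \<Rightarrow> (nat \<Rightarrow>\<^sub>0 nat)" where
  "mon xs = (\<Sum>x\<leftarrow>xs. mv x 1)"

lemma expo_simps [simp]: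
  "expo 0 x = 0" "expo (m + m') x = expo m x + expo m' x" "expo (mv y k) x = (if y = x then k else 0)"
  by (auto simp: expo_def mv_def lookup_add lookup_single when_def)

lemma mon_simps [simp]: "mon [] = 0" "mon (x # xs) = mv x 1 + mon xs" "mon (xs @ ys) = mon xs + mon ys"
  by (auto simp: mon_def)

lemma mon_deg_mv [simp]: "mon_deg (mv x k) = k"
  by (simp add: mv_def)

lemma mon_deg_mon [simp]: "mon_deg (mon xs) = length xs"
  by (induction xs) auto

lemma sum_expo_le_mon_deg: "finite A \<Longrightarrow> (\<Sum>x\<in>A. expo t x) \<le> mon_deg t"
proof -
  assume A: "finite A"
  have "(\<Sum>x\<in>A. expo t x) = (\<Sum>v\<in>to_nat ` A. Poly_Mapping.lookup t v)"
    by (simp add: expo_def sum.reindex inj_on_def)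
  also have "\<dots> \<le> (\<Sum>v\<in>to_nat ` A \<union> Poly_Mapping.keys t. Poly_Mapping.lookup t v)"
    by (rule sum_mono2) (use A in auto)
  also have "\<dots> = mon_deg t"
    by (rule mon_deg_superset[symmetric]) (use A in auto)
  finally show ?thesis .
qed

text \<open>
  Levels are numbered from the top, level 0. At a level with exponent \<open>e\<close>, in lower case, the rules
  of all levels below let \<open>s c\<^sub>i\<close> be replaced by \<open>f c\<^sub>i b\<^sub>i\<^sup>e\<close>. With capitals for the level above, the
  rules yield \<open>S C\<^sub>i = F C\<^sub>i B\<^sub>i\<^sup>E\<close> for \<open>E = e\<^sup>2\<close>: an outer loop moves \<open>b\<^sub>1\<^sup>e\<close> into \<open>b\<^sub>4\<^sup>e\<close>, and each round
  runs an inner loop that moves \<open>b\<^sub>2\<^sup>e\<close> into \<open>b\<^sub>3\<^sup>e\<close> while creating \<open>B\<^sub>i\<^sup>e\<close>.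
\<close>

definition level_rules :: "nat \<Rightarrow> (var list \<times> var list) list" where
  "level_rules d = (let p = Suc d in
    [([vS d], [vS p, vC p I1]),
     ([vF d], [vS p, vC p I4]),
     ([vF p, vC p I1], [vF p, vC p I4]),
     ([vF p, vC p I4, vB p I1], [vS p, vC p I2]),
     ([vS p, vC p I3], [vF p, vC p I1, vB p I4]),
     ([vF p, vC p I2], [vF p, vC p I3])] @
    map (\<lambda>i. ([vF p, vC p I2, vB p I2, vC d i], [vF p, vC p I2, vB p I3, vC d i, vB d i]))
      [I1, I2, I3, I4])"

text \<open>The bottom exponent 2, squared once per level, becomes 2^(2^L) at level 0. Each side of
  a rule has exactly one marker s or f, at its head.\<close>

definition rules :: "nat \<Rightarrow> (var list \<times> var list) list" where
  "rules L = map (\<lambda>i. ([vS L, vC L i], [vF L, vC L i, vB L i, vB L i])) [I1, I2, I3, I4] @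
     concat (map level_rules [0..<L])"

lemma length_rules: "length (rules L) = 10 * L + 4"
  by (simp add: rules_def length_concat level_rules_def Let_def o_def sum_list_triv)

text \<open>
  \<open>good e d x m\<close> says that \<open>m\<close>, multiplied by \<open>f b\<^sub>i\<^sup>x\<close> of level \<open>d\<close> where \<open>c\<^sub>i\<close> is its unique
  context variable there, is congruent to \<open>s c\<^sub>1\<close> of level \<open>0\<close>. The recursion computes the number of
  variables \<open>B\<^sub>i\<close> that the loops of level \<open>d\<close> have yet to create.
\<close>

primrec good :: "(nat \<Rightarrow> nat) \<Rightarrow> nat \<Rightarrow> nat \<Rightarrow> (nat \<Rightarrow>\<^sub>0 nat) \<Rightarrow> bool" where
  "good e 0 x m \<longleftrightarrow> (\<forall>j. expo m (vC 0 j) = (if j = I1 then 1 else 0)) \<and>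
     (\<forall>j. expo m (vB 0 j) + (if j = I1 then x else 0) = (if j = I1 then e 0 else 0))"
| "good e (Suc d) x m \<longleftrightarrow> (\<exists>i. (\<forall>j. expo m (vC (Suc d) j) = (if j = i then 1 else 0)) \<and>
     (let \<beta> = (\<lambda>j. expo m (vB (Suc d) j) + (if j = i then x else 0)) in
      if i = I1 \<or> i = I4
      then \<beta> I2 = 0 \<and> \<beta> I3 = 0 \<and> \<beta> I1 + \<beta> I4 = e (Suc d) \<and> good e d (e (Suc d) * \<beta> I1) m
      else \<beta> I1 + \<beta> I4 + 1 = e (Suc d) \<and> \<beta> I2 + \<beta> I3 = e (Suc d) \<and>
        good e d (e (Suc d) * \<beta> I1 + \<beta> I2) m))"

lemma good_add_mv [simp]:
  "\<forall>d'\<le>d. \<forall>j. y \<noteq> vC d' j \<and> y \<noteq> vB d' j \<Longrightarrow> good e d x (m + mv y k) \<longleftrightarrow> good e d x m"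
  by (induction d arbitrary: x) (simp_all add: Let_def cong: conj_cong)

lemma good_Suc_context:
  "good e (Suc d) x (m + mv (vC (Suc d) i) 1) \<longleftrightarrow> (\<forall>j. expo m (vC (Suc d) j) = 0) \<and>
     (let \<beta> = (\<lambda>j. expo m (vB (Suc d) j) + (if j = i then x else 0)) in
      if i = I1 \<or> i = I4
      then \<beta> I2 = 0 \<and> \<beta> I3 = 0 \<and> \<beta> I1 + \<beta> I4 = e (Suc d) \<and> good e d (e (Suc d) * \<beta> I1) m
      else \<beta> I1 + \<beta> I4 + 1 = e (Suc d) \<and> \<beta> I2 + \<beta> I3 = e (Suc d) \<and>
        good e d (e (Suc d) * \<beta> I1 + \<beta> I2) m)"
proof -
  have "(\<forall>j. expo (m + mv (vC (Suc d) i) 1) (vC (Suc d) j) = (if j = i' then 1 else 0)) \<longleftrightarrow>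
      i' = i \<and> (\<forall>j. expo m (vC (Suc d) j) = 0)" for i'
    by (cases i; cases i') (auto simp: all_idx)
  then show ?thesis by (simp add: good.simps Let_def)
qed

text \<open>A unit of \<open>x\<close> is a variable \<open>b_i\<close> not yet written;
  \<open>good\<close> sees only the total at the counter selected by the context.\<close>

lemma good_context_count:
  "good e d (Suc x) (m + mv (vC d i) 1) \<longleftrightarrow> good e d x (m + mv (vC d i) 1 + mv (vB d i) 1)"
proof (cases d)
  case 0
  then show ?thesis by (cases i) (auto simp: all_idx)
next
  case (Suc d')
  have "good e d x (m + mv (vC d i) 1 + mv (vB d i) 1) \<longleftrightarrow> good e d x ((m + mv (vB d i) 1) + mv (vC d i) 1)"
    by (simp add: ac_simps)
  then show ?thesis
    unfolding Suc good_Suc_context by (cases i) (auto simp: Let_def)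
qed

section \<open>Configurations and their invariance under the rules\<close>

text \<open>The contexts of the levels up to the active level \<open>d\<close> act as a call stack.
  Markers are left out because a configuration carries exactly one, which \<open>reach\<close> adds;
  z, u and v may occur with any exponent.\<close>

definition level_vars :: "nat \<Rightarrow> var set" where
  "level_vars d = {vZ, vU, vV} \<union> {vC d' i | d' i. d' \<le> d} \<union> {vB d' i | d' i. d' \<le> d}"

definition supp :: "nat \<Rightarrow> (nat \<Rightarrow>\<^sub>0 nat) \<Rightarrow> bool" where
  "supp d m \<longleftrightarrow> Poly_Mapping.keys m \<subseteq> to_nat ` level_vars d"

lemma supp_iff:
  "supp d m \<longleftrightarrow> Poly_Mapping.keys m \<subseteq> range (to_nat :: var \<Rightarrow> nat) \<and> (\<forall>x. x \<notin> level_vars d \<longrightarrow> expo m x = 0)"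
  unfolding supp_def expo_def by (fastforce simp: subset_eq in_keys_iff)

lemma supp_add [simp]: "supp d (a + b) \<longleftrightarrow> supp d a \<and> supp d b"
  by (force simp: supp_def subset_eq in_keys_iff lookup_add)

lemma supp_mv [simp]: "supp d (mv y k) \<longleftrightarrow> k = 0 \<or> y \<in> level_vars d"
  by (auto simp: supp_def mv_def)

lemma level_vars_simps [simp]:
  "vZ \<in> level_vars d" "vU \<in> level_vars d" "vV \<in> level_vars d"
  "vS d' \<notin> level_vars d" "vF d' \<notin> level_vars d"
  "vC d' i \<in> level_vars d \<longleftrightarrow> d' \<le> d" "vB d' i \<in> level_vars d \<longleftrightarrow> d' \<le> d"
  by (auto simp: level_vars_def)

lemma supp_expo: "supp d m \<Longrightarrow> x \<notin> level_vars d \<Longrightarrow> expo m x = 0"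
  by (force simp: supp_def expo_def in_keys_iff)

text \<open>At level \<open>d\<close> the contexts and counters of the next level must be empty;
  this is what the first two rules of \<open>level_rules\<close> test.\<close>

lemma supp_Suc:
  "supp d m \<longleftrightarrow> supp (Suc d) m \<and> (\<forall>j. expo m (vC (Suc d) j) = 0) \<and> (\<forall>j. expo m (vB (Suc d) j) = 0)"
proof -
  have eq: "x \<notin> level_vars d \<longleftrightarrow> x \<notin> level_vars (Suc d) \<or> (\<exists>j. x = vC (Suc d) j \<or> x = vB (Suc d) j)" for x
    by (cases x) (auto simp: le_Suc_eq)
  show ?thesis unfolding supp_iff eq by (simp add: all_conj_distrib imp_disjL disj_imp) metis
qed

definition conf :: "(nat \<Rightarrow> nat) \<Rightarrow> nat \<Rightarrow> nat \<Rightarrow> (nat \<Rightarrow>\<^sub>0 nat) \<Rightarrow> bool" where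
  "conf e d x m \<longleftrightarrow> supp d m \<and> good e d x m"

text \<open>The marker s of level \<open>d\<close> stands for f together with \<open>e d\<close>
  units that are still to be written, hence the pending counts \<open>e d\<close> and 0.\<close>

definition reach :: "(nat \<Rightarrow> nat) \<Rightarrow> (nat \<Rightarrow>\<^sub>0 nat) set" where
  "reach e = {w + mv (vS d) 1 | w d. conf e d (e d) w} \<union> {w + mv (vF d) 1 | w d. conf e d 0 w}"

text \<open>A configuration contains no marker of its own, so the marker in the product determines
  both the level and the cofactor. The same applies to \<open>reach_F\<close>.\<close>

lemma reach_S: "w + mv (vS d) 1 \<in> reach e \<longleftrightarrow> conf e d (e d) w"
proof
  assume "w + mv (vS d) 1 \<in> reach e"
  then consider w' d' where "w + mv (vS d) 1 = w' + mv (vS d') 1" "conf e d' (e d') w'"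
    | w' d' where "w + mv (vS d) 1 = w' + mv (vF d') 1" "conf e d' 0 w'"
    by (auto simp: reach_def)
  then show "conf e d (e d) w"
  proof cases
    case 1
    have "expo (w + mv (vS d) 1) (vS d) = expo (w' + mv (vS d') 1) (vS d)" by (simp only: 1(1))
    then have "d' = d" using 1(2) by (auto simp: conf_def supp_expo split: if_splits)
    with 1 show ?thesis by simp
  next
    case 2
    have "expo (w + mv (vS d) 1) (vS d) = expo (w' + mv (vF d') 1) (vS d)" by (simp only: 2(1))
    then show ?thesis using 2(2) by (auto simp: conf_def supp_expo)
  qed
qed (auto simp: reach_def)

lemma reach_F: "w + mv (vF d) 1 \<in> reach e \<longleftrightarrow> conf e d 0 w"
proof
  assume "w + mv (vF d) 1 \<in> reach e"
  then consider w' d' where "w + mv (vF d) 1 = w' + mv (vS d') 1" "conf e d' (e d') w'"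
    | w' d' where "w + mv (vF d) 1 = w' + mv (vF d') 1" "conf e d' 0 w'"
    by (auto simp: reach_def)
  then show "conf e d 0 w"
  proof cases
    case 2
    have "expo (w + mv (vF d) 1) (vF d) = expo (w' + mv (vF d') 1) (vF d)" by (simp only: 2(1))
    then have "d' = d" using 2(2) by (auto simp: conf_def supp_expo split: if_splits)
    with 2 show ?thesis by simp
  next
    case 1
    have "expo (w + mv (vF d) 1) (vF d) = expo (w' + mv (vS d') 1) (vF d)" by (simp only: 1(1))
    then show ?thesis using 1(2) by (auto simp: conf_def supp_expo)
  qed
qed (auto simp: reach_def)

lemma conf_context:
  "conf e (Suc d) x (m + mv (vC (Suc d) i) 1) \<longleftrightarrow> supp (Suc d) m \<and> (\<forall>j. expo m (vC (Suc d) j) = 0) \<and>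
     (let \<beta> = (\<lambda>j. expo m (vB (Suc d) j) + (if j = i then x else 0)) in
      if i = I1 \<or> i = I4
      then \<beta> I2 = 0 \<and> \<beta> I3 = 0 \<and> \<beta> I1 + \<beta> I4 = e (Suc d) \<and> good e d (e (Suc d) * \<beta> I1) m
      else \<beta> I1 + \<beta> I4 + 1 = e (Suc d) \<and> \<beta> I2 + \<beta> I3 = e (Suc d) \<and>
        good e d (e (Suc d) * \<beta> I1 + \<beta> I2) m)"
  unfolding conf_def good_Suc_context by simp

lemma level_rules_cases:
  assumes "(l, r) \<in> set (level_rules d)"
  shows "l = [vS d] \<and> r = [vS (Suc d), vC (Suc d) I1] \<or>
    l = [vF d] \<and> r = [vS (Suc d), vC (Suc d) I4] \<or>
    l = [vF (Suc d), vC (Suc d) I1] \<and> r = [vF (Suc d), vC (Suc d) I4] \<or>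
    l = [vF (Suc d), vC (Suc d) I4, vB (Suc d) I1] \<and> r = [vS (Suc d), vC (Suc d) I2] \<or>
    l = [vS (Suc d), vC (Suc d) I3] \<and> r = [vF (Suc d), vC (Suc d) I1, vB (Suc d) I4] \<or>
    l = [vF (Suc d), vC (Suc d) I2] \<and> r = [vF (Suc d), vC (Suc d) I3] \<or>
    (\<exists>i. l = [vF (Suc d), vC (Suc d) I2, vB (Suc d) I2, vC d i] \<and>
         r = [vF (Suc d), vC (Suc d) I2, vB (Suc d) I3, vC d i, vB d i])"
  using assms unfolding level_rules_def Let_def
  by (simp only: append.simps list.map list.set insert_iff empty_iff prod.inject) metis

text \<open>Every rule keeps the number of units pending for level \<open>d\<close>. Starting a
  round trades one b_1, worth e units, for e variables b_2 worth one unit each; the inner loop turns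
  one b_2 into b_3 and writes one unit. The square appears when counter 1 is filled: e variables b_1
  are worth e * e.\<close>

lemma level_rules_sound:
  assumes "(l, r) \<in> set (level_rules d)" and e: "e d = e (Suc d) * e (Suc d)"
  shows "w + mon l \<in> reach e \<longleftrightarrow> w + mon r \<in> reach e"
proof -
  let ?p = "Suc d"
  have rF: "w + mon (vF d' # vC d' i # xs) \<in> reach e \<longleftrightarrow> conf e d' 0 (w + mon xs + mv (vC d' i) 1)" for d' i xs
    using reach_F[of "w + mon xs + mv (vC d' i) 1" d' e] by (simp add: ac_simps)
  have rS: "w + mon (vS d' # vC d' i # xs) \<in> reach e \<longleftrightarrow> conf e d' (e d') (w + mon xs + mv (vC d' i) 1)" for d' i xs
    using reach_S[of "w + mon xs + mv (vC d' i) 1" d' e] by (simp add: ac_simps)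
  have rS1: "w + mon [vS d] \<in> reach e \<longleftrightarrow> conf e d (e d) w"
    and rF1: "w + mon [vF d] \<in> reach e \<longleftrightarrow> conf e d 0 w"
    by (simp_all only: mon_simps add_0_right reach_S reach_F)
  show ?thesis using level_rules_cases[OF assms(1)]
  proof (elim disjE conjE exE)
    assume lr: "l = [vS d]" "r = [vS ?p, vC ?p I1]"
    show ?thesis unfolding lr rS rS1 conf_context
      by (auto simp: conf_def supp_Suc[of d w] all_idx Let_def e)
  next
    assume lr: "l = [vF d]" "r = [vS ?p, vC ?p I4]"
    show ?thesis unfolding lr rS rF1 conf_context
      by (auto simp: conf_def supp_Suc[of d w] all_idx Let_def)
  next
    assume lr: "l = [vF ?p, vC ?p I1]" "r = [vF ?p, vC ?p I4]"
    show ?thesis unfolding lr rF conf_context by (auto simp: Let_def)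
  next
    assume lr: "l = [vF ?p, vC ?p I4, vB ?p I1]" "r = [vS ?p, vC ?p I2]"
    show ?thesis unfolding lr rF rS conf_context by (auto simp: Let_def algebra_simps)
  next
    assume lr: "l = [vS ?p, vC ?p I3]" "r = [vF ?p, vC ?p I1, vB ?p I4]"
    show ?thesis unfolding lr rF rS conf_context by (auto simp: Let_def algebra_simps)
  next
    assume lr: "l = [vF ?p, vC ?p I2]" "r = [vF ?p, vC ?p I3]"
    show ?thesis unfolding lr rF conf_context by (auto simp: Let_def)
  next
    fix i assume lr: "l = [vF ?p, vC ?p I2, vB ?p I2, vC d i]" "r = [vF ?p, vC ?p I2, vB ?p I3, vC d i, vB d i]"
    have 1: "good e d x (w + (mv (vB ?p I2) 1 + (mv (vC d i) 1 + 0))) \<longleftrightarrow> good e d x (w + mv (vC d i) 1)"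
      for x using good_add_mv[of d "vB ?p I2" e x "w + mv (vC d i) 1" 1] by (simp add: ac_simps)
    have 2: "good e d x (w + (mv (vB ?p I3) 1 + (mv (vC d i) 1 + (mv (vB d i) 1 + 0)))) \<longleftrightarrow>
        good e d (Suc x) (w + mv (vC d i) 1)"
      for x
      using good_add_mv[of d "vB ?p I3" e x "w + mv (vC d i) 1 + mv (vB d i) 1" 1]
        good_context_count[of e d x w i] by (simp add: ac_simps)
    show ?thesis unfolding lr rF conf_context unfolding mon_simps 1 2 by (auto simp: Let_def)
  qed
qed

lemma bottom_rules_sound:
  assumes "e L = 2"
  shows "w + mon [vS L, vC L i] \<in> reach e \<longleftrightarrow> w + mon [vF L, vC L i, vB L i, vB L i] \<in> reach e"
proof -
  have "w + mon [vS L, vC L i] \<in> reach e \<longleftrightarrow> conf e L 2 (w + mv (vC L i) 1)"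
    using reach_S[of "w + mv (vC L i) 1" L e] assms by (simp add: ac_simps)
  also have "\<dots> \<longleftrightarrow> conf e L 1 ((w + mv (vB L i) 1) + mv (vC L i) 1)"
    using good_context_count[of e L 1 w i] by (simp add: conf_def ac_simps numeral_2_eq_2)
  also have "\<dots> \<longleftrightarrow> conf e L 0 ((w + mv (vB L i) 1) + mv (vC L i) 1 + mv (vB L i) 1)"
    using good_context_count[of e L 0 "w + mv (vB L i) 1" i] by (simp add: conf_def)
  also have "\<dots> \<longleftrightarrow> w + mon [vF L, vC L i, vB L i, vB L i] \<in> reach e"
    using reach_F[of "(w + mv (vB L i) 1) + mv (vC L i) 1 + mv (vB L i) 1" L e] by (simp add: ac_simps)
  finally show ?thesis .
qed

lemma rules_sound:
  assumes "(l, r) \<in> set (rules L)" and "e L = 2" and "\<And>d. d < L \<Longrightarrow> e d = e (Suc d) * e (Suc d)"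
  shows "w + mon l \<in> reach e \<longleftrightarrow> w + mon r \<in> reach e"
  using assms(1) bottom_rules_sound[of e L, OF assms(2)] level_rules_sound assms(3)
  by (auto simp: rules_def simp del: mon_simps)

lemma rules_vars:
  assumes "(l, r) \<in> set (rules L)"
  shows "length l \<le> 5" "length r \<le> 5" "set l \<union> set r \<subseteq> - {vZ, vU, vV}" "l \<noteq> r"
  using assms by (auto simp: rules_def level_rules_def Let_def)

lemma supp_no_context:
  assumes "supp 0 t" "\<And>j. expo t (vC 0 j) = 0" "\<And>j. expo t (vB 0 j) = 0"
  shows "t = mv vU (expo t vU) + mv vV (expo t vV) + mv vZ (expo t vZ)"
proof (rule poly_mapping_eqI)
  fix v
  show "Poly_Mapping.lookup t v = Poly_Mapping.lookup (mv vU (expo t vU) + mv vV (expo t vV) + mv vZ (expo t vZ)) v"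
  proof (cases "v \<in> range (to_nat :: var \<Rightarrow> nat)")
    case True
    then obtain x where v: "v = to_nat (x :: var)" by blast
    have "expo t x = expo (mv vU (expo t vU) + mv vV (expo t vV) + mv vZ (expo t vZ)) x"
    proof (cases "x \<in> level_vars 0")
      case True
      then show ?thesis using assms(2,3) by (auto simp: level_vars_def)
    next
      case False
      then show ?thesis using supp_expo[OF assms(1) False] by auto
    qed
    then show ?thesis by (simp only: expo_def v)
  next
    case False
    moreover from this have "Poly_Mapping.lookup t v = 0"
      using assms(1) by (auto simp: supp_iff in_keys_iff)
    ultimately show ?thesis by (auto simp: lookup_add mv_def lookup_single when_def)
  qed
qed

text \<open>With s at level 0 all \<open>e 0\<close> units are pending, which leaves no room for any
  b_1, and the only context allowed is already in the start word.\<close>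

lemma reach_start:
  assumes "t + mon [vS 0, vC 0 I1] \<in> reach e"
  shows "t = mv vU (expo t vU) + mv vV (expo t vV) + mv vZ (expo t vZ)"
proof -
  have "conf e 0 (e 0) (t + mv (vC 0 I1) 1)"
    using reach_S[of "t + mv (vC 0 I1) 1" 0 e] assms by (simp add: ac_simps)
  then have c: "supp 0 t" "\<forall>j. expo (t + mv (vC 0 I1) 1) (vC 0 j) = (if j = I1 then 1 else 0)"
    "\<forall>j. expo (t + mv (vC 0 I1) 1) (vB 0 j) + (if j = I1 then e 0 else 0) = (if j = I1 then e 0 else 0)"
    by (simp_all add: conf_def)
  have "expo t (vC 0 j) = 0" for j using c(2)[rule_format, of j] by (cases j) auto
  moreover have "expo t (vB 0 j) = 0" for j using c(3)[rule_format, of j] by (cases j) auto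
  ultimately show ?thesis using supp_no_context[OF c(1)] by blast
qed

lemma reach_start_power:
  "mv vU i + mv vV j + mv vZ k + mon [vS 0, vC 0 I1] \<in> reach e"
proof -
  have "conf e 0 (e 0) (mv vU i + mv vV j + mv vZ k + mv (vC 0 I1) 1)"
    by (simp add: conf_def)
  then show ?thesis
    using reach_S[of "mv vU i + mv vV j + mv vZ k + mv (vC 0 I1) 1" 0 e] by (simp add: ac_simps)
qed

text \<open>After f at level 0 nothing is pending, so all \<open>e 0\<close> units b_1 are present.
  This is the source of the doubly exponential degree.\<close>

lemma reach_accept:
  assumes "t + mon [vF 0] \<in> reach e"
  shows "mon_deg t \<ge> e 0 + 1 + expo t vU + expo t vV + expo t vZ"
proof -
  have "conf e 0 0 t" using reach_F[of t 0 e] assms by (simp add: ac_simps)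
  then have "expo t (vC 0 I1) = 1" "expo t (vB 0 I1) = e 0" by (auto simp: conf_def all_idx)
  then show ?thesis
    using sum_expo_le_mon_deg[of "{vC 0 I1, vB 0 I1, vU, vV, vZ}" t] by simp
qed

section \<open>Monomials as polynomials and closure properties of ideals\<close>

definition pm :: "(nat \<Rightarrow>\<^sub>0 nat) \<Rightarrow> 'k::field mpoly" where
  "pm m = Poly_Mapping.single m 1"

lemma pm_add: "pm (a + b) = pm a * pm b"
  by (simp add: pm_def mult_single)

lemma homogeneous_pm: "int (mon_deg m) = e \<Longrightarrow> homogeneous e (pm m)"
  unfolding pm_def by (rule homogeneous_single)

lemma generated_ideal_closed:
  assumes "p \<in> generated_ideal n m f"
  shows "q \<in> generated_ideal n m f \<Longrightarrow> p + q \<in> generated_ideal n m f"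
    and "s \<in> polys n \<Longrightarrow> s * p \<in> generated_ideal n m f"
    and "- p \<in> generated_ideal n m f"
proof -
  obtain a where a: "p = (\<Sum>i<m. a i * f i)" "\<forall>i<m. a i \<in> polys n"
    using assms by (auto simp: generated_ideal_def)
  show mult: "s * p \<in> generated_ideal n m f" if "s \<in> polys n" for s
    unfolding generated_ideal_def mem_Collect_eq
    by (rule exI[of _ "\<lambda>i. s * a i"]) (use a that in \<open>auto simp: sum_distrib_left mult.assoc\<close>)
  from mult[of "- 1"] show "- p \<in> generated_ideal n m f" by simp
  assume "q \<in> generated_ideal n m f"
  then obtain b where b: "q = (\<Sum>i<m. b i * f i)" "\<forall>i<m. b i \<in> polys n"
    by (auto simp: generated_ideal_def)
  show "p + q \<in> generated_ideal n m f"
    unfolding generated_ideal_def mem_Collect_eq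
    by (rule exI[of _ "\<lambda>i. a i + b i"]) (use a b in \<open>auto simp: algebra_simps sum.distrib\<close>)
qed

lemma generated_ideal_gen: "i < m \<Longrightarrow> f i \<in> generated_ideal n m f"
  unfolding generated_ideal_def mem_Collect_eq
  by (rule exI[of _ "\<lambda>j. if j = i then 1 else 0"]) (simp add: if_distrib[of "\<lambda>x. x * _"] cong: if_cong)

section \<open>The binomial ideal of the rewriting system\<close>

definition pad :: "var list \<Rightarrow> var list" where
  "pad xs = replicate (5 - length xs) vZ @ xs"

text \<open>The position matters: with the start monomial at index 0, its coefficient in a syzygy is
  the only one that a packed multiplier shows at v^4.\<close>

definition gens :: "nat \<Rightarrow> 'k::field mpoly list" where
  "gens L = pm (mon (pad [vS 0, vC 0 I1])) # pm (mon (pad [vF 0])) #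
     map (\<lambda>(l, r). pm (mon (pad l)) - pm (mon (pad r))) (rules L)"

lemma mv_add: "mv x (a + b) = mv x a + mv x b"
  by (simp add: mv_def single_add)

lemma mv_0 [simp]: "mv x 0 = 0"
  by (simp add: mv_def)

lemma mon_replicate: "mon (replicate k x) = mv x k"
  by (induction k) (simp_all flip: mv_add)

lemma mon_pad: "mon (pad xs) = mv vZ (5 - length xs) + mon xs"
  by (simp add: pad_def mon_replicate)

lemma length_gens: "length (gens L) = 10 * L + 6"
  by (simp add: gens_def length_rules)

definition vars :: "nat \<Rightarrow> var set" where
  "vars L = level_vars L \<union> vS ` {..L} \<union> vF ` {..L}"

text \<open>The ring also contains the variables whose numbers lie between those in use;
  \<open>supp\<close> keeps them out of configurations.\<close>

definition nvars :: "nat \<Rightarrow> nat" where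
  "nvars L = Suc (Max (to_nat ` vars L))"

lemma finite_vars: "finite (vars L)"
proof -
  have fin: "finite (UNIV :: idx set)"
    by (rule finite_subset[of _ "{I1, I2, I3, I4}"]) (use idx.exhaust in auto)
  have "vars L \<subseteq> {vZ, vU, vV} \<union> (\<lambda>(d, i). vC d i) ` ({..L} \<times> UNIV) \<union> (\<lambda>(d, i). vB d i) ` ({..L} \<times> UNIV)
      \<union> vS ` {..L} \<union> vF ` {..L}"
    by (auto simp: vars_def level_vars_def)
  then show ?thesis by (rule finite_subset) (use fin in auto)
qed

definition mon_in_vars :: "nat \<Rightarrow> (nat \<Rightarrow>\<^sub>0 nat) \<Rightarrow> bool" where
  "mon_in_vars L m \<longleftrightarrow> Poly_Mapping.keys m \<subseteq> {..<nvars L}"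

lemma mon_in_vars_0 [simp]: "mon_in_vars L 0"
  by (simp add: mon_in_vars_def)

lemma mon_in_vars_add [simp]: "mon_in_vars L a \<Longrightarrow> mon_in_vars L b \<Longrightarrow> mon_in_vars L (a + b)"
  using keys_add[of a b] by (auto simp: mon_in_vars_def)

lemma mon_in_vars_mv [simp]: "x \<in> vars L \<Longrightarrow> mon_in_vars L (mv x k)"
  using finite_vars by (auto simp: mon_in_vars_def mv_def nvars_def less_Suc_eq_le)

lemma vars_simps [simp]:
  "vZ \<in> vars L" "vU \<in> vars L" "vV \<in> vars L" "vS d \<in> vars L \<longleftrightarrow> d \<le> L" "vF d \<in> vars L \<longleftrightarrow> d \<le> L"
  "vC d i \<in> vars L \<longleftrightarrow> d \<le> L" "vB d i \<in> vars L \<longleftrightarrow> d \<le> L"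
  by (auto simp: vars_def)

lemma pm_polys [simp]: "mon_in_vars L m \<Longrightarrow> pm m \<in> polys (nvars L)"
  by (auto simp: mon_in_vars_def pm_def intro: polys_single)

lemma mon_in_vars_mon: "set xs \<subseteq> vars L \<Longrightarrow> mon_in_vars L (mon xs)"
  by (induction xs) auto

lemma rules_vars_bounded: "(l, r) \<in> set (rules L) \<Longrightarrow> set l \<union> set r \<subseteq> vars L"
  by (auto simp: rules_def level_rules_def Let_def)

lemma gens_cases:
  assumes "p \<in> set (gens L)"
  obtains xs where "p = pm (mon (pad xs))" "set xs \<subseteq> vars L" "length xs \<le> 5"
  | l r where "(l, r) \<in> set (rules L)" "p = pm (mon (pad l)) - pm (mon (pad r))"
  using assms that(1)[of "[vS 0, vC 0 I1]"] that(1)[of "[vF 0]"] that(2)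
  by (auto simp: gens_def)

lemma pm_pad_polys: "set xs \<subseteq> vars L \<Longrightarrow> pm (mon (pad xs)) \<in> polys (nvars L)"
  unfolding mon_pad by (intro pm_polys) (simp add: mon_in_vars_mon)

lemma homogeneous_pm_pad: "length xs \<le> 5 \<Longrightarrow> homogeneous 5 (pm (mon (pad xs)))"
  by (rule homogeneous_pm) (simp add: mon_pad)

lemma gens_polys:
  assumes "p \<in> set (gens L)"
  shows "p \<in> polys (nvars L)" "homogeneous 5 p"
  using assms by (cases rule: gens_cases;
      use rules_vars_bounded[of _ _ L] rules_vars(1,2)[of _ _ L] in
        \<open>auto intro!: homogeneous_diff homogeneous_pm_pad pm_pad_polys polys_closed(5)\<close>)+

text \<open>The index shift omits the start monomial, so a multiple z^K of it lying here amounts to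
  a syzygy with coefficient z^K at the start monomial.\<close>

definition rel_ideal :: "nat \<Rightarrow> 'k::field mpoly set" where
  "rel_ideal L = generated_ideal (nvars L) (Suc (length (rules L))) (\<lambda>i. gens L ! Suc i)"

lemma rel_ideal_closed:
  assumes "p \<in> rel_ideal L"
  shows "q \<in> rel_ideal L \<Longrightarrow> p + q \<in> rel_ideal L"
    and "s \<in> polys (nvars L) \<Longrightarrow> s * p \<in> rel_ideal L"
    and "- p \<in> rel_ideal L"
  using generated_ideal_closed[OF assms[unfolded rel_ideal_def]] unfolding rel_ideal_def by blast+

lemma rel_ideal_gen: "p \<in> set (tl (gens L)) \<Longrightarrow> p \<in> rel_ideal L"
  using generated_ideal_gen[of _ "Suc (length (rules L))" "\<lambda>i. gens L ! Suc i" "nvars L"]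
  unfolding rel_ideal_def in_set_conv_nth by (auto simp: nth_tl length_gens length_rules)

section \<open>Running the system: congruence up to powers of z\<close>

text \<open>Padded sides of a rule carry different powers of z. In the end only some exponent K is
  wanted, so these powers are quantified away. The type argument fixes the field.\<close>

definition zcong :: "'k::field itself \<Rightarrow> nat \<Rightarrow> (nat \<Rightarrow>\<^sub>0 nat) \<Rightarrow> (nat \<Rightarrow>\<^sub>0 nat) \<Rightarrow> bool" where
  "zcong _ L m m' \<longleftrightarrow> (\<exists>a b. pm (mv vZ a + m) - pm (mv vZ b + m') \<in> (rel_ideal L :: 'k mpoly set))"

lemma zcong_sym: "zcong k L m m' \<Longrightarrow> zcong k L m' m"
  unfolding zcong_def using rel_ideal_closed(3) by (metis minus_diff_eq)

lemma zcong_refl: "zcong k L m m"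
proof -
  have "0 * pm (mon (pad [vF 0])) \<in> rel_ideal L"
    by (rule rel_ideal_closed(2)[OF rel_ideal_gen]) (auto simp: gens_def)
  then have "pm (mv vZ 0 + m) - pm (mv vZ 0 + m) \<in> rel_ideal L" by simp
  then show ?thesis unfolding zcong_def by blast
qed

lemma zcong_trans [trans]:
  assumes "zcong k L m m'" "zcong k L m' m''"
  shows "zcong k L m m''"
proof -
  obtain a b a' b' where 1: "pm (mv vZ a + m) - pm (mv vZ b + m') \<in> (rel_ideal L :: 'a mpoly set)"
    and 2: "pm (mv vZ a' + m') - pm (mv vZ b' + m'') \<in> (rel_ideal L :: 'a mpoly set)"
    using assms unfolding zcong_def by blast
  have z: "pm (mv vZ j) \<in> polys (nvars L)" for j by simp
  have "pm (mv vZ a') * (pm (mv vZ a + m) - pm (mv vZ b + m')) +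
      pm (mv vZ b) * (pm (mv vZ a' + m') - pm (mv vZ b' + m'')) \<in> (rel_ideal L :: 'a mpoly set)"
    by (intro rel_ideal_closed(1) rel_ideal_closed(2)[OF 1 z] rel_ideal_closed(2)[OF 2 z])
  also have "pm (mv vZ a') * (pm (mv vZ a + m) - pm (mv vZ b + m')) +
      pm (mv vZ b) * (pm (mv vZ a' + m') - pm (mv vZ b' + m'')) =
      (pm (mv vZ (a' + a) + m) - pm (mv vZ (b + b') + m'') :: 'a mpoly)"
    by (simp add: pm_add mv_add algebra_simps)
  finally show ?thesis unfolding zcong_def by blast
qed

lemma zcong_mult:
  assumes "zcong k L m m'" "mon_in_vars L w"
  shows "zcong k L (w + m) (w + m')"
proof -
  obtain a b where 1: "pm (mv vZ a + m) - pm (mv vZ b + m') \<in> (rel_ideal L :: 'a mpoly set)"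
    using assms unfolding zcong_def by blast
  have "pm w * (pm (mv vZ a + m) - pm (mv vZ b + m')) \<in> (rel_ideal L :: 'a mpoly set)"
    by (rule rel_ideal_closed(2)[OF 1]) (use assms in simp)
  also have "pm w * (pm (mv vZ a + m) - pm (mv vZ b + m')) =
      (pm (mv vZ a + (w + m)) - pm (mv vZ b + (w + m')) :: 'a mpoly)"
    by (simp add: pm_add algebra_simps)
  finally show ?thesis unfolding zcong_def by blast
qed

lemma zcong_rule:
  assumes "(l, r) \<in> set (rules L)"
  shows "zcong k L (mon l) (mon r)"
proof -
  have "pm (mon (pad l)) - pm (mon (pad r)) \<in> rel_ideal L"
    by (rule rel_ideal_gen) (use assms in \<open>force simp: gens_def\<close>)
  then show ?thesis unfolding zcong_def mon_pad by blast
qed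

lemma zcong_rule_mult:
  assumes "(l, r) \<in> set (rules L)" "mon_in_vars L w"
  shows "zcong k L (w + mon l) (w + mon r)"
  using zcong_mult[OF zcong_rule] assms by blast

lemma in_rules: "d < L \<Longrightarrow> x \<in> set (level_rules d) \<Longrightarrow> x \<in> set (rules L)"
  by (auto simp: rules_def)

text \<open>Two nested loops with E passes each write E * E units. The routine of the next level
  fills a counter with E units; read backwards it empties a full counter and so confirms that a loop
  is complete.\<close>

lemma zcong_level:
  assumes "d < L" and IH: "\<And>i. zcong k L (mv (vS (Suc d)) 1 + mv (vC (Suc d) i) 1)
      (mv (vF (Suc d)) 1 + mv (vC (Suc d) i) 1 + mv (vB (Suc d) i) E)"
  shows "zcong k L (mv (vS d) 1 + mv (vC d i) 1) (mv (vF d) 1 + mv (vC d i) 1 + mv (vB d i) (E * E))"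
proof -
  let ?p = "Suc d"
  let ?s = "mv (vS ?p) 1" and ?f = "mv (vF ?p) 1" and ?c = "\<lambda>j. mv (vC ?p j) 1" and ?b = "\<lambda>j x. mv (vB ?p j) x"
  let ?C = "mv (vC d i) 1" and ?B = "\<lambda>x. mv (vB d i) x"
  have dL: "d \<le> L" "?p \<le> L" using assms(1) by auto
  note R = in_rules[OF assms(1)]
  have r1: "zcong k L (w + mv (vS d) 1) (w + ?s + ?c I1)" if "mon_in_vars L w" for w
    using zcong_rule_mult[OF R that, of "[vS d]" "[vS ?p, vC ?p I1]" k]
    by (simp add: level_rules_def Let_def ac_simps)
  have r2: "zcong k L (w + mv (vF d) 1) (w + ?s + ?c I4)" if "mon_in_vars L w" for w
    using zcong_rule_mult[OF R that, of "[vF d]" "[vS ?p, vC ?p I4]" k]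
    by (simp add: level_rules_def Let_def ac_simps)
  have r3: "zcong k L (w + ?f + ?c I1) (w + ?f + ?c I4)" if "mon_in_vars L w" for w
    using zcong_rule_mult[OF R that, of "[vF ?p, vC ?p I1]" "[vF ?p, vC ?p I4]" k]
    by (simp add: level_rules_def Let_def ac_simps)
  have r4: "zcong k L (w + ?f + ?c I4 + ?b I1 1) (w + ?s + ?c I2)" if "mon_in_vars L w" for w
    using zcong_rule_mult[OF R that, of "[vF ?p, vC ?p I4, vB ?p I1]" "[vS ?p, vC ?p I2]" k]
    by (simp add: level_rules_def Let_def ac_simps)
  have r5: "zcong k L (w + ?s + ?c I3) (w + ?f + ?c I1 + ?b I4 1)" if "mon_in_vars L w" for w
    using zcong_rule_mult[OF R that, of "[vS ?p, vC ?p I3]" "[vF ?p, vC ?p I1, vB ?p I4]" k]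
    by (simp add: level_rules_def Let_def ac_simps)
  have r6: "zcong k L (w + ?f + ?c I2) (w + ?f + ?c I3)" if "mon_in_vars L w" for w
    using zcong_rule_mult[OF R that, of "[vF ?p, vC ?p I2]" "[vF ?p, vC ?p I3]" k]
    by (simp add: level_rules_def Let_def ac_simps)
  have r7: "zcong k L (w + ?f + ?c I2 + ?b I2 1 + ?C) (w + ?f + ?c I2 + ?b I3 1 + ?C + ?B 1)" if "mon_in_vars L w" for w
    using zcong_rule_mult[OF R that, of "[vF ?p, vC ?p I2, vB ?p I2, vC d i]"
        "[vF ?p, vC ?p I2, vB ?p I3, vC d i, vB d i]" k]
    by (cases i) (simp_all add: level_rules_def Let_def ac_simps)
  have call: "zcong k L (w + ?s + ?c j) (w + ?f + ?c j + ?b j E)" if "mon_in_vars L w" for w j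
    using zcong_mult[OF IH that, of j] by (simp add: ac_simps)
  have inner: "zcong k L (w + ?f + ?c I2 + ?b I2 x + ?C) (w + ?f + ?c I2 + ?b I3 x + ?C + ?B x)"
    if "mon_in_vars L w" for w x
    using that
  proof (induction x arbitrary: w)
    case (Suc x)
    have "zcong k L ((w + ?b I2 x) + ?f + ?c I2 + ?b I2 1 + ?C) ((w + ?b I2 x) + ?f + ?c I2 + ?b I3 1 + ?C + ?B 1)"
      by (rule r7) (use Suc.prems dL in simp)
    also have "(w + ?b I2 x) + ?f + ?c I2 + ?b I3 1 + ?C + ?B 1 = (w + ?b I3 1 + ?B 1) + ?f + ?c I2 + ?b I2 x + ?C"
      by (simp add: ac_simps)
    also have "zcong k L \<dots> ((w + ?b I3 1 + ?B 1) + ?f + ?c I2 + ?b I3 x + ?C + ?B x)"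
      by (rule Suc.IH) (use Suc.prems dL in simp)
    finally show ?case
      by (simp only: mv_add[of _ 1 x, unfolded plus_1_eq_Suc] ac_simps)
  qed (simp add: zcong_refl)
  \<comment> \<open>One pass of the outer loop: a b_1 pays for filling b_2, the inner loop moves
    this filling to b_3, and the reversed call empties b_3 before b_4 records the pass.\<close>
  have round: "zcong k L (w + ?f + ?c I4 + ?b I1 1 + ?C) (w + ?f + ?c I4 + ?b I4 1 + ?C + ?B E)"
    if w: "mon_in_vars L w" for w
  proof -
    have "zcong k L ((w + ?C) + ?f + ?c I4 + ?b I1 1) ((w + ?C) + ?s + ?c I2)"
      by (rule r4) (use w dL in simp)
    also have "zcong k L \<dots> ((w + ?C) + ?f + ?c I2 + ?b I2 E)"
      by (rule call) (use w dL in simp)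
    also have "\<dots> = w + ?f + ?c I2 + ?b I2 E + ?C" by (simp add: ac_simps)
    also have "zcong k L \<dots> (w + ?f + ?c I2 + ?b I3 E + ?C + ?B E)"
      by (rule inner) (use w dL in simp)
    also have "\<dots> = (w + ?b I3 E + ?C + ?B E) + ?f + ?c I2" by (simp add: ac_simps)
    also have "zcong k L \<dots> ((w + ?b I3 E + ?C + ?B E) + ?f + ?c I3)"
      by (rule r6) (use w dL in simp)
    also have "\<dots> = (w + ?C + ?B E) + ?f + ?c I3 + ?b I3 E" by (simp add: ac_simps)
    also have "zcong k L \<dots> ((w + ?C + ?B E) + ?s + ?c I3)"
      by (rule zcong_sym, rule call) (use w dL in simp)
    also have "zcong k L \<dots> ((w + ?C + ?B E) + ?f + ?c I1 + ?b I4 1)"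
      by (rule r5) (use w dL in simp)
    also have "\<dots> = (w + ?C + ?B E + ?b I4 1) + ?f + ?c I1" by (simp add: ac_simps)
    also have "zcong k L \<dots> ((w + ?C + ?B E + ?b I4 1) + ?f + ?c I4)"
      by (rule r3) (use w dL in simp)
    finally show ?thesis by (simp only: ac_simps)
  qed
  have outer: "zcong k L (w + ?f + ?c I4 + ?b I1 x + ?C) (w + ?f + ?c I4 + ?b I4 x + ?C + ?B (E * x))"
    if "mon_in_vars L w" for w x
    using that
  proof (induction x arbitrary: w)
    case (Suc x)
    have "zcong k L ((w + ?b I1 x) + ?f + ?c I4 + ?b I1 1 + ?C) ((w + ?b I1 x) + ?f + ?c I4 + ?b I4 1 + ?C + ?B E)"
      by (rule round) (use Suc.prems dL in simp)
    also have "(w + ?b I1 x) + ?f + ?c I4 + ?b I4 1 + ?C + ?B E = (w + ?b I4 1 + ?B E) + ?f + ?c I4 + ?b I1 x + ?C"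
      by (simp add: ac_simps)
    also have "zcong k L \<dots> ((w + ?b I4 1 + ?B E) + ?f + ?c I4 + ?b I4 x + ?C + ?B (E * x))"
      by (rule Suc.IH) (use Suc.prems dL in simp)
    finally show ?case
      by (simp only: mv_add[of _ 1 x, unfolded plus_1_eq_Suc] mult_Suc_right mv_add[of _ E "E * x"] ac_simps)
  qed (simp add: zcong_refl)
  have "zcong k L (?C + mv (vS d) 1) (?C + ?s + ?c I1)"
    by (rule r1) (use dL in simp)
  also have "zcong k L \<dots> (?C + ?f + ?c I1 + ?b I1 E)"
    by (rule call) (use dL in simp)
  also have "\<dots> = (?C + ?b I1 E) + ?f + ?c I1" by (simp add: ac_simps)
  also have "zcong k L \<dots> ((?C + ?b I1 E) + ?f + ?c I4)"
    by (rule r3) (use dL in simp)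
  also have "\<dots> = 0 + ?f + ?c I4 + ?b I1 E + ?C" by (simp add: ac_simps)
  also have "zcong k L \<dots> (0 + ?f + ?c I4 + ?b I4 E + ?C + ?B (E * E))"
    by (rule outer) simp
  also have "\<dots> = (?C + ?B (E * E)) + ?f + ?c I4 + ?b I4 E" by (simp add: ac_simps)
  \<comment> \<open>The reversed call consumes the full counter b_4, so control can return to level
    \<open>d\<close>.\<close>
  also have "zcong k L \<dots> ((?C + ?B (E * E)) + ?s + ?c I4)"
    by (rule zcong_sym, rule call) (use dL in simp)
  also have "zcong k L \<dots> ((?C + ?B (E * E)) + mv (vF d) 1)"
    by (rule zcong_sym, rule r2) (use dL in simp)
  finally show ?thesis by (simp only: ac_simps)
qed

lemma zcong_square:
  "d \<le> L \<Longrightarrow> zcong k L (mv (vS d) 1 + mv (vC d i) 1) (mv (vF d) 1 + mv (vC d i) 1 + mv (vB d i) (2 ^ 2 ^ (L - d)))"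
proof (induction "L - d" arbitrary: d i)
  case 0
  then have d: "d = L" by simp
  have "([vS L, vC L i], [vF L, vC L i, vB L i, vB L i]) \<in> set (rules L)"
    by (cases i) (simp_all add: rules_def)
  from zcong_rule[OF this, of k] show ?case
    using mv_add[of "vB L i" 1 1] by (simp add: d ac_simps numeral_2_eq_2)
next
  case (Suc x)
  then have "d < L" by simp
  have e: "(2::nat) ^ 2 ^ (L - d) = 2 ^ 2 ^ (L - Suc d) * 2 ^ 2 ^ (L - Suc d)"
    using \<open>d < L\<close> by (simp add: Suc_diff_Suc flip: power_add mult_2 power_Suc)
  show ?case unfolding e by (rule zcong_level[OF \<open>d < L\<close>]) (use Suc in auto)
qed

lemma start_in_rel_ideal:
  obtains K where "pm (mv vZ K) * hd (gens L) \<in> (rel_ideal L :: 'k::field mpoly set)"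
proof -
  let ?e = "2 ^ 2 ^ L"
  let ?I = "rel_ideal L :: 'k mpoly set"
  let ?m = "mv (vC 0 I1) 1 + mv (vB 0 I1) ?e"
  obtain a b where 1: "pm (mv vZ a + (mv (vS 0) 1 + mv (vC 0 I1) 1)) -
      pm (mv vZ b + (mv (vF 0) 1 + mv (vC 0 I1) 1 + mv (vB 0 I1) ?e)) \<in> ?I"
    using zcong_square[of 0 L "TYPE('k)" I1] unfolding zcong_def by auto
  have "pm (mon (pad [vF 0])) \<in> ?I"
    by (rule rel_ideal_gen) (simp add: gens_def)
  then have "pm (mv vZ b + mv vZ 3 + ?m) * pm (mon (pad [vF 0])) \<in> ?I"
    by (rule rel_ideal_closed(2)) simp
  \<comment> \<open>The factor z^7 suffices to split off the padding z^3 of the start monomial on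
    one side and z^4 of the accepting monomial on the other.\<close>
  moreover have "pm (mv vZ 7) * (pm (mv vZ a + (mv (vS 0) 1 + mv (vC 0 I1) 1)) -
      pm (mv vZ b + (mv (vF 0) 1 + mv (vC 0 I1) 1 + mv (vB 0 I1) ?e))) \<in> ?I"
    by (rule rel_ideal_closed(2)[OF 1]) simp
  ultimately have "pm (mv vZ 7) * (pm (mv vZ a + (mv (vS 0) 1 + mv (vC 0 I1) 1)) -
      pm (mv vZ b + (mv (vF 0) 1 + mv (vC 0 I1) 1 + mv (vB 0 I1) ?e))) +
      pm (mv vZ b + mv vZ 3 + ?m) * pm (mon (pad [vF 0])) \<in> ?I"
    by (metis rel_ideal_closed(1))
  also have "pm (mv vZ 7) * (pm (mv vZ a + (mv (vS 0) 1 + mv (vC 0 I1) 1)) -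
      pm (mv vZ b + (mv (vF 0) 1 + mv (vC 0 I1) 1 + mv (vB 0 I1) ?e))) +
      pm (mv vZ b + mv vZ 3 + ?m) * pm (mon (pad [vF 0])) = pm (mv vZ (a + 4)) * (hd (gens L) :: 'k mpoly)"
  proof -
    have "mv vZ 7 = mv vZ 3 + mv vZ 4" using mv_add[of vZ 3 4] by simp
    then show ?thesis
      by (simp add: gens_def mon_pad mv_add pm_add algebra_simps)
  qed
  finally show thesis by (rule that)
qed

section \<open>The three forms\<close>

text \<open>This linear functional kills all multiples of a binomial whose two monomials translate
  into \<open>Y\<close> alike, so it tests ideal membership without a Groebner basis.\<close>

definition msum :: "(nat \<Rightarrow>\<^sub>0 nat) set \<Rightarrow> 'k::field mpoly \<Rightarrow> 'k" where
  "msum Y p = (\<Sum>t\<in>Poly_Mapping.keys p. if t \<in> Y then Poly_Mapping.lookup p t else 0)"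

lemma msum_superset:
  assumes "finite A" "Poly_Mapping.keys p \<subseteq> A"
  shows "msum Y p = (\<Sum>t\<in>A. if t \<in> Y then Poly_Mapping.lookup p t else 0)"
  unfolding msum_def by (rule sum.mono_neutral_left) (use assms in \<open>auto simp: in_keys_iff\<close>)

lemma msum_zero [simp]: "msum Y 0 = 0"
  by (simp add: msum_def)

lemma msum_add: "msum Y (p + q) = msum Y p + msum Y q"
proof -
  let ?A = "Poly_Mapping.keys p \<union> Poly_Mapping.keys q"
  have "msum Y (p + q) = (\<Sum>t\<in>?A. if t \<in> Y then Poly_Mapping.lookup (p + q) t else 0)"
    by (rule msum_superset) (use keys_add[of p q] in auto)
  also have "\<dots> = (\<Sum>t\<in>?A. (if t \<in> Y then Poly_Mapping.lookup p t else 0) +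
      (if t \<in> Y then Poly_Mapping.lookup q t else 0))"
    by (intro sum.cong) (auto simp: lookup_add)
  also have "\<dots> = msum Y p + msum Y q"
    by (simp add: sum.distrib msum_superset[of ?A p] msum_superset[of ?A q])
  finally show ?thesis .
qed

lemma msum_diff: "msum Y (p - q) = msum Y p - msum Y q"
  using msum_add[of Y "p - q" q] by simp

lemma msum_sum: "msum Y (\<Sum>i\<in>A. f i) = (\<Sum>i\<in>A. msum Y (f i))"
  by (induction A rule: infinite_finite_induct) (simp_all add: msum_add)

lemma msum_single: "msum Y (Poly_Mapping.single t c) = (if t \<in> Y then c else 0)"
  by (simp add: msum_superset[of "{t}"])

lemma msum_mult_pm:
  "msum Y (q * pm w) = (\<Sum>t\<in>Poly_Mapping.keys q. if t + w \<in> Y then Poly_Mapping.lookup q t else 0)"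
proof -
  have "q * pm w = (\<Sum>t\<in>Poly_Mapping.keys q. Poly_Mapping.single t (Poly_Mapping.lookup q t)) * pm w"
    using poly_mapping_eq_sum_single[of "Poly_Mapping.keys q" q] by simp
  then show ?thesis by (simp add: sum_distrib_right pm_def mult_single msum_sum msum_single)
qed

lemma msum_mult_pm_cong:
  assumes "\<And>t. t + w \<in> Y \<longleftrightarrow> t + w' \<in> Y"
  shows "msum Y (q * pm w) = msum Y (q * pm w')"
  unfolding msum_mult_pm assms ..

lemma msum_mult_pm_0:
  assumes "\<And>t. t + w \<notin> Y"
  shows "msum Y (q * pm w) = 0"
  using assms by (simp add: msum_mult_pm)

lemma msum_mult_pm_unique:
  assumes "\<And>t. t + w \<in> Y \<longleftrightarrow> t = \<tau>"
  shows "msum Y (q * pm w) = Poly_Mapping.lookup q \<tau>"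
proof -
  have "msum Y (q * pm w) = (\<Sum>t\<in>Poly_Mapping.keys q. if t = \<tau> then Poly_Mapping.lookup q t else 0)"
    by (simp add: msum_mult_pm assms)
  then show ?thesis by (simp add: in_keys_iff)
qed

text \<open>Configurations put no condition on z, so padding does not affect membership. The marker
  at the head gives access to the configuration.\<close>

lemma reach_mv_Z:
  assumes "hd l \<in> range vS \<union> range vF" "l \<noteq> []"
  shows "w + mon l + mv vZ k \<in> reach e \<longleftrightarrow> w + mon l \<in> reach e"
proof -
  obtain y ys where l: "l = y # ys" using assms(2) by (cases l) auto
  have Z: "conf e d x (w + mon ys + mv vZ k) \<longleftrightarrow> conf e d x (w + mon ys)" for d x
    by (simp add: conf_def)
  consider d where "y = vS d" | d where "y = vF d" using assms(1) l by auto
  then show ?thesis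
  proof cases
    case (1 d)
    show ?thesis
      using reach_S[of "w + mon ys + mv vZ k" d e] reach_S[of "w + mon ys" d e] Z
      by (simp add: l 1 ac_simps)
  next
    case (2 d)
    show ?thesis
      using reach_F[of "w + mon ys + mv vZ k" d e] reach_F[of "w + mon ys" d e] Z
      by (simp add: l 2 ac_simps)
  qed
qed

lemma rules_hd:
  assumes "(l, r) \<in> set (rules L)"
  shows "hd l \<in> range vS \<union> range vF" "l \<noteq> []" "hd r \<in> range vS \<union> range vF" "r \<noteq> []"
  using assms by (auto simp: rules_def level_rules_def Let_def)

lemma expo_mon_eq_0: "x \<notin> set xs \<Longrightarrow> expo (mon xs) x = 0"
  by (induction xs) auto

section \<open>Multipliers of the third form modulo the two pure powers\<close>

text \<open>The exponents are true differences for every index exactly when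
  \<open>10 * L + 10 <= D\<close>, the hypothesis of the lemmas below.\<close>

definition third_form :: "nat \<Rightarrow> nat \<Rightarrow> 'k::field mpoly" where
  "third_form L D = (\<Sum>l<10 * L + 6. gens L ! l * pm (mv vU l + mv vV (D - 5 - l)))"

text \<open>Prescribing exponents of u and v below D replaces reduction modulo u^D and v^D. All i <
  D and j < 5 are covered, not only D - 1 and 4, because the vanishing conditions must later define
  a submodule.\<close>

lemma colon_coeff_zero:
  fixes q :: "'k::field mpoly"
  assumes eq: "q * third_form L D = \<alpha> * pm (mv vU D) + \<beta> * pm (mv vV D)"
    and D: "10 * L + 10 \<le> D" and i: "i < D" and j: "j < 5" and k: "k \<le> 2 ^ 2 ^ L"
  shows "Poly_Mapping.lookup q (mv vU i + mv vV j + mv vZ k) = 0"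
proof -
  define e :: "nat \<Rightarrow> nat" where "e d = 2 ^ 2 ^ (L - d)" for d
  have e: "e L = 2" "\<And>d. d < L \<Longrightarrow> e d = e (Suc d) * e (Suc d)"
    by (simp_all add: e_def Suc_diff_Suc flip: power_add mult_2 power_Suc)
  \<comment> \<open>These are the data of u^i v^j z^k times the start term, which contains v^(D-5)
    and has degree D; j < 5 keeps the exponent of v below D.\<close>
  define Y where "Y = {t \<in> reach e. mon_deg t = k + i + j + D \<and> expo t vU = i \<and> expo t vV = j + D - 5}"
  let ?m = "\<lambda>l. mv vU l + mv vV (D - 5 - l)"
  have "msum Y (\<alpha> * pm (mv vU D)) = 0"
    by (rule msum_mult_pm_0) (use i in \<open>auto simp: Y_def\<close>)
  moreover have "msum Y (\<beta> * pm (mv vV D)) = 0"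
    by (rule msum_mult_pm_0) (use j D in \<open>auto simp: Y_def\<close>)
  ultimately have "msum Y (q * third_form L D) = 0"
    by (simp add: eq msum_add)
  moreover have "q * third_form L D = (\<Sum>l<10 * L + 6. q * (gens L ! l * pm (?m l)))"
    by (simp add: third_form_def sum_distrib_left)
  ultimately have "(\<Sum>l<10 * L + 6. msum Y (q * (gens L ! l * pm (?m l)))) = 0"
    by (simp add: msum_sum)
  moreover have "msum Y (q * (gens L ! l * pm (?m l))) = 0" if l: "0 < l" "l < 10 * L + 6" for l
  proof (cases "l = 1")
    case True
    have "t + (mon (pad [vF 0]) + ?m 1) \<notin> Y" for t
    proof
      assume t: "t + (mon (pad [vF 0]) + ?m 1) \<in> Y"
      let ?t = "t + mv vZ 4 + ?m 1"
      have eqt: "t + (mon (pad [vF 0]) + ?m 1) = ?t + mon [vF 0]"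
        by (simp add: mon_pad ac_simps)
      \<comment> \<open>With the four padding factors z this forces \<open>e 0 < k\<close>, against
        the bound on \<open>k\<close>.\<close>
      have "e 0 + 1 + expo ?t vU + expo ?t vV + expo ?t vZ \<le> mon_deg ?t"
        by (rule reach_accept) (use t eqt in \<open>simp add: Y_def\<close>)
      moreover have "expo ?t vU = i" "expo ?t vV = j + D - 5" "mon_deg ?t + 1 = k + i + j + D"
        using t unfolding eqt by (simp_all add: Y_def)
      moreover have "expo ?t vZ \<ge> 4" by simp
      moreover have "k \<le> e 0" using k by (simp add: e_def)
      ultimately show False using D by linarith
    qed
    from msum_mult_pm_0[of _ Y q, OF this] show ?thesis
      using True by (simp add: gens_def pm_add algebra_simps)
  next
    case False
    then have "(gens L ! l :: 'k mpoly) \<in> (\<lambda>(a, b). pm (mon (pad a)) - pm (mon (pad b))) ` set (rules L)"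
      using l length_rules[of L] by (simp add: gens_def nth_Cons' )
    then obtain a b where ab: "(a, b) \<in> set (rules L)" "(gens L ! l :: 'k mpoly) = pm (mon (pad a)) - pm (mon (pad b))"
      by auto
    note V = rules_vars[OF ab(1)]
    have "t + (mon (pad a) + ?m l) \<in> Y \<longleftrightarrow> t + (mon (pad b) + ?m l) \<in> Y" for t
    proof -
      let ?w = "t + ?m l"
      have "?w + mon (pad a) \<in> reach e \<longleftrightarrow> ?w + mon (pad b) \<in> reach e"
        using reach_mv_Z[OF rules_hd(1,2)[OF ab(1)], of ?w _ e] reach_mv_Z[OF rules_hd(3,4)[OF ab(1)], of ?w _ e]
          rules_sound[OF ab(1) e, of ?w]
        by (simp add: mon_pad add.assoc[symmetric] add.commute[of _ "mon _"])
      moreover have "expo (mon (pad a)) x = 0" "expo (mon (pad b)) x = 0" if "x \<in> {vU, vV}" for x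
        using V(3) that by (auto simp: mon_pad intro!: expo_mon_eq_0)
      moreover have "mon_deg (mon (pad a)) = mon_deg (mon (pad b))"
        using V(1,2) by (simp add: mon_pad)
      ultimately show ?thesis by (simp add: Y_def ac_simps)
    qed
    from msum_mult_pm_cong[of _ Y _ q, OF this] show ?thesis
      by (simp add: ab(2) pm_add algebra_simps msum_diff)
  qed
  ultimately have 0: "msum Y (q * (gens L ! 0 * pm (?m 0))) = 0"
    using sum.remove[of "{..<10 * L + 6}" 0 "\<lambda>l. msum Y (q * (gens L ! l * pm (?m l)))"] by simp
  \<comment> \<open>By \<open>reach_start\<close> only u, v and z can occur in the cofactor; the
    prescribed exponents and degree then leave a single \<open>t\<close>.\<close>
  have "t + (mon (pad [vS 0, vC 0 I1]) + ?m 0) \<in> Y \<longleftrightarrow> t = mv vU i + mv vV j + mv vZ k" for t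
  proof -
    let ?t = "t + mv vZ 3 + ?m 0"
    have eqt: "t + (mon (pad [vS 0, vC 0 I1]) + ?m 0) = ?t + mon [vS 0, vC 0 I1]"
      by (simp add: mon_pad ac_simps)
    have V: "mv vV (j + D - 5) = mv vV j + mv vV (D - 5)"
      using D by (simp flip: mv_add)
    show ?thesis
    proof
      assume "t + (mon (pad [vS 0, vC 0 I1]) + ?m 0) \<in> Y"
      then have t: "?t + mon [vS 0, vC 0 I1] \<in> reach e" "expo ?t vU = i" "expo ?t vV = j + D - 5"
        "mon_deg ?t + 2 = k + i + j + D" unfolding eqt by (simp_all add: Y_def)
      have *: "?t = mv vU i + mv vV (j + D - 5) + mv vZ (expo ?t vZ)"
        using reach_start[OF t(1)] unfolding t(2,3) .
      then have "mon_deg ?t = mon_deg (mv vU i + mv vV (j + D - 5) + mv vZ (expo ?t vZ))" by (rule arg_cong)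
      then have "expo ?t vZ = k + 3" using t(4) D unfolding mon_deg_add mon_deg_mv by linarith
      then have "?t = mv vU i + mv vV (j + D - 5) + mv vZ (k + 3)" using * by metis
      then have "t + (mv vZ 3 + mv vV (D - 5)) = (mv vU i + mv vV j + mv vZ k) + (mv vZ 3 + mv vV (D - 5))"
        unfolding V mv_add[of vZ] by (simp add: ac_simps)
      then show "t = mv vU i + mv vV j + mv vZ k" by (rule add_right_imp_eq)
    next
      assume t: "t = mv vU i + mv vV j + mv vZ k"
      have "?t = mv vU i + mv vV (j + D - 5) + mv vZ (k + 3)"
        unfolding V mv_add[of vZ] t by (simp add: ac_simps)
      then show "t + (mon (pad [vS 0, vC 0 I1]) + ?m 0) \<in> Y"
        unfolding eqt using reach_start_power[of i "j + D - 5" "k + 3" e] D by (simp add: Y_def)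
    qed
  qed
  from msum_mult_pm_unique[of _ Y _ q, OF this] 0 show ?thesis
    by (simp add: gens_def pm_add algebra_simps)
qed

text \<open>Pack a syzygy with first coefficient z^K using complementary monomials. In the product
  with the third form, the term with indices i, l is divisible by u^D if i < l and by v^D if l < i;
  the terms with i = l share u^(D-1) v^(D-1) and add up to 0 by the syzygy.\<close>

lemma colon_witness:
  assumes D: "10 * L + 10 \<le> D"
  obtains c \<alpha> \<beta> :: "'k::field mpoly" and K where
    "c \<in> polys (nvars L)" "\<alpha> \<in> polys (nvars L)" "\<beta> \<in> polys (nvars L)"
    "c * third_form L D = \<alpha> * pm (mv vU D) + \<beta> * pm (mv vV D)"
    "Poly_Mapping.lookup c (mv vU (D - 1) + mv vV 4 + mv vZ K) \<noteq> 0"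
proof -
  let ?N = "10 * L + 6" and ?R = "polys (nvars L) :: 'k mpoly set" and ?g = "\<lambda>i. gens L ! i :: 'k mpoly"
  have N: "?N = Suc (Suc (length (rules L)))" by (simp add: length_rules)
  obtain K where "pm (mv vZ K) * hd (gens L) \<in> (rel_ideal L :: 'k mpoly set)"
    by (rule start_in_rel_ideal)
  then obtain b where b: "pm (mv vZ K) * hd (gens L) = (\<Sum>i<Suc (length (rules L)). b i * ?g (Suc i))"
    "\<forall>i<Suc (length (rules L)). b i \<in> ?R"
    by (auto simp: rel_ideal_def generated_ideal_def)
  define a where "a i = (case i of 0 \<Rightarrow> pm (mv vZ K) | Suc i \<Rightarrow> - b i)" for i
  have aR: "a i \<in> ?R" if "i < ?N" for i
    using that b(2) unfolding N by (cases i) (auto simp: a_def)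
  have gR: "?g i \<in> ?R" if "i < ?N" for i
    using that by (intro gens_polys nth_mem) (simp add: length_gens)
  have "hd (gens L) = ?g 0" by (simp add: gens_def)
  then have syz: "(\<Sum>i<?N. a i * ?g i) = 0"
    unfolding N sum.lessThan_Suc_shift[of _ "Suc _"] using b(1) by (simp add: a_def sum_negf)
  define c where "c = (\<Sum>i<?N. a i * pm (mv vU (D - 1 - i) + mv vV (4 + i)))"
  define A where "A i l = (if i < l then a i * ?g l * pm (mv vU (l - i - 1) + mv vV (D - 1 + i - l)) else 0)" for i l
  define B where "B i l = (if l < i then a i * ?g l * pm (mv vU (D - 1 + l - i) + mv vV (i - l - 1)) else 0)" for i l
  have prod_eq: "(a i * pm (mv vU (D - 1 - i) + mv vV (4 + i))) * (?g l * pm (mv vU l + mv vV (D - 5 - l))) =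
      A i l * pm (mv vU D) + B i l * pm (mv vV D) +
      (if l = i then a i * ?g i * pm (mv vU (D - 1) + mv vV (D - 1)) else 0)"
    if "i < ?N" "l < ?N" for i l
  proof -
    have "(mv vU (D - 1 - i) + mv vV (4 + i)) + (mv vU l + mv vV (D - 5 - l)) =
        mv vU (D - 1 - i + l) + mv vV (4 + i + (D - 5 - l))"
      unfolding mv_add by (simp add: ac_simps)
    also have "D - 1 - i + l = D - 1 + l - i" using that D by linarith
    also have "4 + i + (D - 5 - l) = D - 1 + i - l" using that D by linarith
    finally have "pm (mv vU (D - 1 - i) + mv vV (4 + i)) * pm (mv vU l + mv vV (D - 5 - l)) =
        (pm (mv vU (D - 1 + l - i) + mv vV (D - 1 + i - l)) :: 'k mpoly)"
      by (simp flip: pm_add)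
    then have lhs: "(a i * pm (mv vU (D - 1 - i) + mv vV (4 + i))) * (?g l * pm (mv vU l + mv vV (D - 5 - l))) =
        a i * ?g l * pm (mv vU (D - 1 + l - i) + mv vV (D - 1 + i - l))"
      by (metis (no_types, lifting) mult.assoc mult.left_commute)
    consider "i < l" | "l < i" | "i = l" by linarith
    then show ?thesis
    proof cases
      case 1
      then have "D - 1 + l - i = (l - i - 1) + D" using D by simp
      then have "pm (mv vU (D - 1 + l - i) + mv vV (D - 1 + i - l)) =
          (pm (mv vU (l - i - 1) + mv vV (D - 1 + i - l)) * pm (mv vU D) :: 'k mpoly)"
        by (simp add: mv_add ac_simps flip: pm_add)
      then show ?thesis unfolding lhs using 1 by (simp add: A_def B_def mult.assoc)
    next
      case 2
      then have "D - 1 + i - l = (i - l - 1) + D" using D by simp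
      then have "pm (mv vU (D - 1 + l - i) + mv vV (D - 1 + i - l)) =
          (pm (mv vU (D - 1 + l - i) + mv vV (i - l - 1)) * pm (mv vV D) :: 'k mpoly)"
        by (simp add: mv_add ac_simps flip: pm_add)
      then show ?thesis unfolding lhs using 2 by (simp add: A_def B_def mult.assoc)
    next
      case 3
      then show ?thesis unfolding lhs by (simp add: A_def B_def)
    qed
  qed
  define \<alpha> where "\<alpha> = (\<Sum>i<?N. \<Sum>l<?N. A i l)"
  define \<beta> where "\<beta> = (\<Sum>i<?N. \<Sum>l<?N. B i l)"
  have "c * third_form L D = (\<Sum>i<?N. \<Sum>l<?N. A i l * pm (mv vU D) + B i l * pm (mv vV D) +
      (if l = i then a i * ?g i * pm (mv vU (D - 1) + mv vV (D - 1)) else 0))"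
    unfolding c_def third_form_def sum_product
    by (intro sum.cong refl, rule prod_eq) auto
  also have "\<dots> = \<alpha> * pm (mv vU D) + \<beta> * pm (mv vV D) +
      (\<Sum>i<?N. a i * ?g i) * pm (mv vU (D - 1) + mv vV (D - 1))"
    by (simp add: sum.distrib \<alpha>_def \<beta>_def sum_distrib_right)
  finally have eq: "c * third_form L D = \<alpha> * pm (mv vU D) + \<beta> * pm (mv vV D)"
    by (simp add: syz)
  have cR: "c \<in> ?R" unfolding c_def
    by (intro polys_sum polys_mult aR pm_polys) auto
  have "\<alpha> \<in> ?R" unfolding \<alpha>_def
    by (intro polys_sum) (auto simp: A_def intro!: polys_mult aR gR pm_polys)
  moreover have "\<beta> \<in> ?R" unfolding \<beta>_def
    by (intro polys_sum) (auto simp: B_def intro!: polys_mult aR gR pm_polys)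
  moreover have "Poly_Mapping.lookup c (mv vU (D - 1) + mv vV 4 + mv vZ K) = 1"
  proof -
    let ?t = "mv vU (D - 1) + mv vV 4 + mv vZ K"
    \<comment> \<open>For i > 0 the summand is divisible by v^(4+i), so only the summand of z^K
      reaches this monomial.\<close>
    have "Poly_Mapping.lookup (a i * pm (mv vU (D - 1 - i) + mv vV (4 + i))) ?t = (if i = 0 then 1 else 0)" for i
    proof (cases "i = 0")
      case True
      have "a i * pm (mv vU (D - 1 - i) + mv vV (4 + i)) = (pm ?t :: 'k mpoly)"
        using True by (simp add: a_def ac_simps flip: pm_add)
      then show ?thesis using True by (simp add: pm_def)
    next
      case False
      have "?t \<notin> Poly_Mapping.keys (a i * pm (mv vU (D - 1 - i) + mv vV (4 + i)))"
      proof
        assume "?t \<in> Poly_Mapping.keys (a i * pm (mv vU (D - 1 - i) + mv vV (4 + i)))"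
        then obtain s where "?t = s + (mv vU (D - 1 - i) + mv vV (4 + i))"
          using subsetD[OF keys_mult] by (fastforce simp: pm_def)
        then have "expo ?t vV = expo (s + (mv vU (D - 1 - i) + mv vV (4 + i))) vV" by (rule arg_cong)
        with False show False by simp
      qed
      with False show ?thesis by (simp add: in_keys_iff)
    qed
    then show ?thesis by (simp add: c_def lookup_sum)
  qed
  ultimately show thesis using that[OF cR _ _ eq, of K] by simp
qed

lemma lookup_mult_ex:
  assumes "Poly_Mapping.lookup (p * q) t \<noteq> 0"
  obtains a b where "t = a + b" "Poly_Mapping.lookup q b \<noteq> 0"
  using assms subsetD[OF keys_mult[of p q], of t] by (auto simp: in_keys_iff)

lemma exists_three_forms_regularity:
  assumes D: "10 * L + 10 \<le> D"
  shows "\<exists>n (f :: nat \<Rightarrow> 'k::field mpoly). (\<forall>i<3. form_of_degree n D (f i)) \<and>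
    ereal (real D + 2 ^ 2 ^ L) \<le> regularity n (generated_ideal n 3 f)"
proof -
  \<comment> \<open>The vanishing holds up to and including degree 2^(2^L), hence the successor; it
    cancels the - 1 lost in passing to the first Tor.\<close>
  let ?n = "nvars L" and ?Y = "Suc (2 ^ 2 ^ L)"
  define f :: "nat \<Rightarrow> 'k mpoly" where
    "f i = (if i = 0 then pm (mv vU D) else if i = 1 then pm (mv vV D) else third_form L D)" for i
  have sum3: "(\<Sum>i<3. h i) = h 0 + h 1 + h 2" for h :: "nat \<Rightarrow> 'k mpoly"
    by (simp add: numeral_3_eq_3 numeral_2_eq_2)
  have third: "third_form L D \<in> polys ?n" "homogeneous (int D) (third_form L D :: 'k mpoly)"
  proof -
    have g: "gens L ! l \<in> polys ?n" "homogeneous 5 (gens L ! l :: 'k mpoly)" if "l < 10 * L + 6" for l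
      using gens_polys[of "gens L ! l" L] that by (simp_all add: length_gens)
    show "third_form L D \<in> polys ?n" unfolding third_form_def
      by (intro polys_sum polys_mult g pm_polys) auto
    show "homogeneous (int D) (third_form L D :: 'k mpoly)" unfolding third_form_def
    proof (rule homogeneous_sum)
      fix l assume l: "l \<in> {..<10 * L + 6}"
      have "homogeneous (5 + int (D - 5)) (gens L ! l * pm (mv vU l + mv vV (D - 5 - l)) :: 'k mpoly)"
        by (intro homogeneous_mult g homogeneous_pm) (use l D in auto)
      then show "homogeneous (int D) (gens L ! l * pm (mv vU l + mv vV (D - 5 - l)) :: 'k mpoly)"
        using D by simp
    qed
  qed
  \<comment> \<open>Otherwise 1 would be a multiplier, contradicting the vanishing of its
    coefficient at i = j = k = 0.\<close>
  have third_nz: "third_form L D \<noteq> (0 :: 'k mpoly)"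
  proof
    assume "third_form L D = (0 :: 'k mpoly)"
    then have "1 * third_form L D = 0 * pm (mv vU D) + 0 * (pm (mv vV D) :: 'k mpoly)" by simp
    from colon_coeff_zero[OF this D, of 0 0 0] show False using D by simp
  qed
  have pm_nz: "pm m \<noteq> (0 :: 'k mpoly)" for m
    by (metis lookup_single_eq lookup_zero pm_def zero_neq_one)
  have polys: "f i \<in> polys ?n" and hom: "homogeneous (int D) (f i)" and nz: "f i \<noteq> 0" for i
    using third third_nz pm_nz by (auto simp: f_def intro!: homogeneous_pm)
  \<comment> \<open>Only the coordinate at the third form is tested. The tested monomials are closed
    under taking divisors, which makes \<open>U\<close> closed under scaling.\<close>
  define U where "U = {v :: nat \<Rightarrow>\<^sub>0 'k mpoly.
    \<forall>i<D. \<forall>j<5. \<forall>k. Poly_Mapping.lookup (Poly_Mapping.lookup v 2) (mv vU i + mv vV j + mv vZ k) = 0}"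
  let ?syz = "{v \<in> free_module ?n {..<3}. (\<Sum>i<3. Poly_Mapping.lookup v i * f i) = 0}"
  obtain c \<alpha> \<beta> :: "'k mpoly" and K where w: "c \<in> polys ?n" "\<alpha> \<in> polys ?n" "\<beta> \<in> polys ?n"
    "c * third_form L D = \<alpha> * pm (mv vU D) + \<beta> * pm (mv vV D)"
    "Poly_Mapping.lookup c (mv vU (D - 1) + mv vV 4 + mv vZ K) \<noteq> 0"
    by (rule colon_witness[OF D])
  define v0 where "v0 = Poly_Mapping.single 0 (- \<alpha>) + Poly_Mapping.single 1 (- \<beta>) + Poly_Mapping.single (2 :: nat) c"
  have lv0: "Poly_Mapping.lookup v0 0 = - \<alpha>" "Poly_Mapping.lookup v0 1 = - \<beta>" "Poly_Mapping.lookup v0 2 = c"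
    by (simp_all add: v0_def lookup_add lookup_single)
  have "ereal (real D + real ?Y - 1) \<le> regularity ?n (generated_ideal ?n 3 f)"
  proof (rule regularity_ge_of_syzygy[where U = U and ?v0.0 = v0])
    show "f i \<in> polys ?n" "homogeneous (int D) (f i)" for i by (fact polys hom)+
    show "0 \<in> U" by (simp add: U_def)
    show "v + w \<in> U" if "v \<in> U" "w \<in> U" for v w using that by (simp add: U_def lookup_add)
    show "vec_scale s v \<in> U" if v: "v \<in> U" for s v
      unfolding U_def mem_Collect_eq
    proof (intro allI impI, rule ccontr)
      fix i j k assume i: "i < D" and j: "j < (5 :: nat)"
      let ?t = "mv vU i + mv vV j + mv vZ k"
      assume "Poly_Mapping.lookup (Poly_Mapping.lookup (vec_scale s v) 2) ?t \<noteq> 0"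
      then obtain a b where ab: "?t = a + b" "Poly_Mapping.lookup (Poly_Mapping.lookup v 2) b \<noteq> 0"
        unfolding lookup_vec_scale by (rule lookup_mult_ex)
      have expo: "expo a x + expo b x = expo ?t x" for x by (simp only: ab(1) expo_simps)
      have "supp 0 (a + b)" unfolding ab(1)[symmetric] by simp
      then have b: "mv vU (expo b vU) + mv vV (expo b vV) + mv vZ (expo b vZ) = b"
        using expo[of "vC 0 _"] expo[of "vB 0 _"] by (intro supp_no_context[symmetric]) auto
      have "expo b vU < D" "expo b vV < 5" using expo[of vU] expo[of vV] i j by simp_all
      then have "Poly_Mapping.lookup (Poly_Mapping.lookup v 2) (mv vU (expo b vU) + mv vV (expo b vV) + mv vZ (expo b vZ)) = 0"
        using v unfolding U_def by blast
      with ab(2) show False unfolding b by contradiction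
    qed
    show "v \<in> U" if v: "v \<in> ?syz" and h: "vec_homogeneous (\<lambda>_. 0) (int e) v" and e: "e < ?Y" for v e
      unfolding U_def mem_Collect_eq
    proof (intro allI impI, rule ccontr)
      fix i j k assume i: "i < D" and j: "j < (5 :: nat)"
      let ?q = "Poly_Mapping.lookup v 2" and ?t = "mv vU i + mv vV j + mv vZ k"
      assume nz: "Poly_Mapping.lookup ?q ?t \<noteq> 0"
      have "homogeneous (int e) ?q" using h by (simp add: vec_homogeneous_def)
      moreover have "?t \<in> Poly_Mapping.keys ?q" using nz unfolding in_keys_iff .
      ultimately have "int (mon_deg ?t) = int e" unfolding homogeneous_def by (rule bspec)
      then have "mon_deg ?t = e" by (simp only: of_nat_eq_iff)
      then have k: "k \<le> 2 ^ 2 ^ L" using e by simp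
      have "?q * third_form L D = (- Poly_Mapping.lookup v 0) * pm (mv vU D) + (- Poly_Mapping.lookup v 1) * pm (mv vV D)"
        using v by (simp add: sum3 f_def algebra_simps eq_neg_iff_add_eq_0)
      from colon_coeff_zero[OF this D i j k] nz show False by simp
    qed
    show "v0 \<in> ?syz"
      using w by (simp add: free_module_iff sum3 lv0 f_def)
        (auto simp: v0_def lookup_add lookup_single when_def)
    show "v0 \<notin> U"
    proof
      assume "v0 \<in> U"
      then have "Poly_Mapping.lookup c (mv vU (D - 1) + mv vV 4 + mv vZ K) = 0"
        using D by (simp add: U_def lv0)
      with w(5) show False by simp
    qed
  qed simp
  moreover have "\<forall>i<3. form_of_degree ?n D (f i)"
    using polys hom nz by (simp add: form_of_degree_def)
  ultimately show ?thesis by (intro exI[of _ ?n] exI[of _ f]) simp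
qed

section \<open>Numerical estimates and conclusion\<close>

text \<open>With X = 2^(2^(r-1)) the power on the right is X^4. The left side exceeds 22 r - 2 by at
  most X + 22 r <= 23 X, while X >= 4 gives X^4 >= 64 X.\<close>

lemma double_exp_bound:
  assumes "r \<ge> (2::nat)"
  shows "(2::real) ^ 2 ^ (r - 1) + 44 * real r - 6 \<le> real (22 * r - 2) + 2 ^ 2 ^ (r + 1)"
proof -
  define X :: real where "X = 2 ^ 2 ^ (r - 1)"
  have "r + 1 = (r - 1) + 2" using assms by simp
  then have "(2::nat) ^ (r + 1) = 2 ^ (r - 1) * 4" by (simp only: power_add) simp
  then have X4: "2 ^ 2 ^ (r + 1) = X ^ 4" by (simp only: X_def power_mult)
  have "r \<le> 2 ^ (r - 1)"
    using less_exp[of "r - 1"] by linarith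
  then have "2 ^ r \<le> X" unfolding X_def by (intro power_increasing) auto
  moreover have "real r \<le> 2 ^ r" using of_nat_less_two_power[of r, where ?'a = real] by simp
  ultimately have rX: "real r \<le> X" by linarith
  have "(2::real) ^ 2 ^ 1 \<le> X" unfolding X_def
    by (intro power_increasing) (use assms in auto)
  then have X: "4 \<le> X" by simp
  have "4 ^ 3 * X \<le> X ^ 3 * X" using X by (intro mult_right_mono power_mono) auto
  then have "64 * X \<le> X ^ 4" by (simp add: power_eq_if)
  then show ?thesis unfolding X4 X_def[symmetric] using rX X assms by (simp add: of_nat_diff)
qed

theorem theorem2p3:
  shows "(\<forall>r::nat. r \<ge> 2 \<longrightarrow>
           (\<exists>n (f :: nat \<Rightarrow> 'k::field mpoly).
              (\<forall>i<3. form_of_degree n (22 * r - 2) (f i)) \<and>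
              regularity n (generated_ideal n 3 f) \<ge> ereal (2 ^ (2 ^ (r - 1)) + 44 * real r - 6)))
       \<and> (\<forall>\<Phi> :: nat \<Rightarrow> nat \<Rightarrow> nat. regularity_bound TYPE('k) \<Phi> \<longrightarrow>
           (\<exists>c::real. c > 0 \<and>
              (\<forall>\<^sub>F d in sequentially. real (\<Phi> 3 d) \<ge> 2 powr (2 powr (c * real d)))))"
proof -
  have forms: "\<exists>n (f :: nat \<Rightarrow> 'k mpoly). (\<forall>i<3. form_of_degree n (22 * r - 2) (f i)) \<and>
      ereal (2 ^ (2 ^ (r - 1)) + 44 * real r - 6) \<le> regularity n (generated_ideal n 3 f)"
    if r: "r \<ge> 2" for r :: nat
  proof -
    have "10 * (r + 1) + 10 \<le> 22 * r - 2" using r by simp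
    from exists_three_forms_regularity[OF this] show ?thesis
      using double_exp_bound[OF r] by (meson ereal_less_eq(3) order_trans)
  qed
  have "\<exists>c::real. c > 0 \<and> (\<forall>\<^sub>F d in sequentially. real (\<Phi> 3 d) \<ge> 2 powr (2 powr (c * real d)))"
    if \<Phi>: "regularity_bound TYPE('k) \<Phi>" for \<Phi>
  proof (intro exI conjI)
    \<comment> \<open>From d <= 22 r + 19 follows r - 1 >= (d - 41) / 22, which is at least d / 100
      for d >= 100. Any constant below 1/22 would do for large d.\<close>
    show "(1 / 100 :: real) > 0" by simp
    show "\<forall>\<^sub>F d in sequentially. 2 powr (2 powr (1 / 100 * real d)) \<le> real (\<Phi> 3 d)"
    proof (rule eventually_sequentiallyI[of 100])
      fix d :: nat assume d: "100 \<le> d"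
      \<comment> \<open>This is the largest \<open>r\<close> with 22 r - 2 <= d, so the bound for
        degrees at most \<open>d\<close> applies to the three forms.\<close>
      define r where "r = (d + 2) div 22"
      have r: "r \<ge> 2" "22 * r - 2 \<le> d" "d \<le> 22 * r + 19" using d by (auto simp: r_def)
      obtain n and f :: "nat \<Rightarrow> 'k mpoly" where f: "\<And>i. i < 3 \<Longrightarrow> form_of_degree n (22 * r - 2) (f i)"
        "ereal (2 ^ (2 ^ (r - 1)) + 44 * real r - 6) \<le> regularity n (generated_ideal n 3 f)"
        using forms[OF r(1)] by blast
      have "f 0 \<in> generated_ideal n 3 f" by (rule generated_ideal_gen) simp
      moreover have "f 0 \<noteq> 0" using f(1)[of 0] by (simp add: form_of_degree_def)
      ultimately have "generated_ideal n 3 f \<noteq> {0}" by blast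
      then have "regularity n (generated_ideal n 3 f) \<le> ereal (real (\<Phi> 3 d))"
        using \<Phi> f(1) r(2) unfolding regularity_bound_def by blast
      with f(2) have "ereal (2 ^ (2 ^ (r - 1)) + 44 * real r - 6) \<le> ereal (real (\<Phi> 3 d))"
        by (rule order_trans)
      then have "(2::real) ^ 2 ^ (r - 1) + 44 * real r - 6 \<le> real (\<Phi> 3 d)" by (simp only: ereal_less_eq(3))
      moreover have "2 \<le> real r" using r(1) by simp
      ultimately have "(2::real) ^ 2 ^ (r - 1) \<le> real (\<Phi> 3 d)" by linarith
      moreover have "2 powr (2 powr (1 / 100 * real d)) \<le> 2 powr (2 powr real (r - 1))"
        using r d by (intro powr_mono) (auto simp: of_nat_diff)
      moreover have "2 powr (2 powr real (r - 1)) = (2::real) ^ 2 ^ (r - 1)"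
        using powr_realpow[of 2 "2 ^ (r - 1)"] by (simp add: powr_realpow)
      ultimately show "2 powr (2 powr (1 / 100 * real d)) \<le> real (\<Phi> 3 d)" by linarith
    qed
  qed
  with forms show ?thesis by blast
qed

end
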